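(* Let $n \geq 0$ be an integer and let $A$ be a two-sided noetherian semiperfect ring that is $n$-Iwanaga-Gorenstein, and suppose that every indecomposable non-projective module $X \in \operatorname{CM} A$ is periodic. Let $M$ be a finitely generated right $A$-module such that $\operatorname{Ext}_A^u(M,M)=0$ for all $u>n$. Then $M$ has finite projective dimension. In particular, every self-orthogonal finitely generated right $A$-module has finite projective dimension.
   Context: All rings are two-sided noetherian and semiperfect, and all modules are finitely generated right modules unless otherwise stated; $\operatorname{mod} A$ denotes the category of finitely generated right $A$-modules. A ring $A$ is called $n$-Iwanaga-Gorenstein if the injective dimensions of $A$ as a left module and as a right module over itself are both equal to $n$. For a module $M$ and $i \geq 0$, $\Omega^i(M)$ denotes the $i$-th syzygy of $M$ in a minimal projective resolution (which exists since $A$ is noetherian and semiperfect), with $\Omega^0(M)=M$. For an $n$-Iwanaga-Gorenstein ring $A$, the category $\operatorname{CM} A$ of maximal Cohen-Macaulay modules is the full subcategory of $\operatorname{mod} A$ consisting of those modules $X$ that are projective or a direct summand of a module of the form $\Omega^n(N)$ for some $N \in \operatorname{mod} A$. A module $X \in \operatorname{mod} A$ is called periodic if $\Omega^l(X) \cong X$ for some $l \geq 1$. A module $M \in \operatorname{mod} A$ is called self-orthogonal if $\operatorname{Ext}_A^i(M,M)=0$ for all $i \geq 1$. *)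

theory Defs
  imports
    "HOL-Algebra.AbelCoset"
    "HOL-Algebra.Module"
    "HOL-Algebra.Elementary_Groups"
    "HOL-Library.Extended_Nat"
    "HOL-Library.FuncSet"
begin

section \<open>Right modules over a noncommutative ring\<close>

text \<open>
  The locale \<^locale>\<open>module\<close> requires a commutative ring. The record of modules is reused here with
  the scalar written on the left: \<open>a \<odot> x\<close> stands for the right action \<open>x \<cdot> a\<close>, which is why
  the associativity law reads \<open>x \<cdot> (a b) = (x \<cdot> a) \<cdot> b\<close>. The components \<^const>\<open>mult\<close> and \<^const>\<open>one\<close>
  of a module record carry no meaning.
\<close>

locale right_module = R?: ring A + M?: abelian_group M
  for A :: "('a, 'r) ring_scheme" (structure) and M :: "('a, 'm) module" (structure) +
  assumes act_closed:
      "\<lbrakk>a \<in> carrier A; x \<in> carrier M\<rbrakk> \<Longrightarrow> a \<odot>\<^bsub>M\<^esub> x \<in> carrier M"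
    and act_add_scalar:
      "\<lbrakk>a \<in> carrier A; b \<in> carrier A; x \<in> carrier M\<rbrakk> \<Longrightarrow>
        (a \<oplus>\<^bsub>A\<^esub> b) \<odot>\<^bsub>M\<^esub> x = a \<odot>\<^bsub>M\<^esub> x \<oplus>\<^bsub>M\<^esub> b \<odot>\<^bsub>M\<^esub> x"
    and act_add:
      "\<lbrakk>a \<in> carrier A; x \<in> carrier M; y \<in> carrier M\<rbrakk> \<Longrightarrow>
        a \<odot>\<^bsub>M\<^esub> (x \<oplus>\<^bsub>M\<^esub> y) = a \<odot>\<^bsub>M\<^esub> x \<oplus>\<^bsub>M\<^esub> a \<odot>\<^bsub>M\<^esub> y"
    and act_mult:
      "\<lbrakk>a \<in> carrier A; b \<in> carrier A; x \<in> carrier M\<rbrakk> \<Longrightarrow>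
        (a \<otimes>\<^bsub>A\<^esub> b) \<odot>\<^bsub>M\<^esub> x = b \<odot>\<^bsub>M\<^esub> (a \<odot>\<^bsub>M\<^esub> x)"
    and act_one:
      "x \<in> carrier M \<Longrightarrow> \<one>\<^bsub>A\<^esub> \<odot>\<^bsub>M\<^esub> x = x"

text \<open>Left modules over a ring are right modules over its opposite ring.\<close>

definition opposite_ring :: "('a, 'r) ring_scheme \<Rightarrow> ('a, 'r) ring_scheme"
  where "opposite_ring A = A\<lparr>mult := (\<lambda>x y. y \<otimes>\<^bsub>A\<^esub> x)\<rparr>"

definition regular_module :: "('a, 'r) ring_scheme \<Rightarrow> ('a, 'a) module"
  where "regular_module A =
    \<lparr>carrier = carrier A, mult = mult A, one = \<one>\<^bsub>A\<^esub>, zero = \<zero>\<^bsub>A\<^esub>, add = add A,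
     smult = (\<lambda>a x. x \<otimes>\<^bsub>A\<^esub> a)\<rparr>"

abbreviation restrict_module :: "('a, 'm) module \<Rightarrow> 'm set \<Rightarrow> ('a, 'm) module"
  where "restrict_module M U \<equiv> M\<lparr>carrier := U\<rparr>"

definition fg_module :: "('a, 'r) ring_scheme \<Rightarrow> ('a, 'm) module \<Rightarrow> bool"
  where "fg_module A M \<longleftrightarrow> right_module A M \<and>
    (\<exists>S. finite S \<and> S \<subseteq> carrier M \<and>
      (\<forall>U. submodule U A M \<and> S \<subseteq> U \<longrightarrow> U = carrier M))"

definition zero_module :: "('a, 'm) module \<Rightarrow> bool"
  where "zero_module M \<longleftrightarrow> carrier M = {\<zero>\<^bsub>M\<^esub>}"

text \<open>Homomorphisms are extensional, so that equality in Hom is equality of functions.\<close>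

definition mod_hom ::
  "('a, 'r) ring_scheme \<Rightarrow> ('a, 'm) module \<Rightarrow> ('a, 'n) module \<Rightarrow> ('m \<Rightarrow> 'n) set"
  where "mod_hom A M N = {f \<in> carrier M \<rightarrow>\<^sub>E carrier N.
    (\<forall>x \<in> carrier M. \<forall>y \<in> carrier M. f (x \<oplus>\<^bsub>M\<^esub> y) = f x \<oplus>\<^bsub>N\<^esub> f y) \<and>
    (\<forall>a \<in> carrier A. \<forall>x \<in> carrier M. f (a \<odot>\<^bsub>M\<^esub> x) = a \<odot>\<^bsub>N\<^esub> f x)}"

definition mod_iso ::
  "('a, 'r) ring_scheme \<Rightarrow> ('a, 'm) module \<Rightarrow> ('a, 'n) module \<Rightarrow> bool"
  where "mod_iso A M N \<longleftrightarrow> (\<exists>f \<in> mod_hom A M N. bij_betw f (carrier M) (carrier N))"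

definition right_noetherian :: "('a, 'r) ring_scheme \<Rightarrow> bool"
  where "right_noetherian A \<longleftrightarrow>
    (\<forall>I. submodule I A (regular_module A) \<longrightarrow>
      fg_module A (restrict_module (regular_module A) I))"

definition two_sided_noetherian :: "('a, 'r) ring_scheme \<Rightarrow> bool"
  where "two_sided_noetherian A \<longleftrightarrow> right_noetherian A \<and> right_noetherian (opposite_ring A)"

definition internal_direct_sum ::
  "('a, 'r) ring_scheme \<Rightarrow> ('a, 'm) module \<Rightarrow> 'm set \<Rightarrow> 'm set \<Rightarrow> bool"
  where "internal_direct_sum A M U V \<longleftrightarrow> submodule U A M \<and> submodule V A M \<and>
    U \<inter> V = {\<zero>\<^bsub>M\<^esub>} \<and> U <+>\<^bsub>M\<^esub> V = carrier M"

definition indecomposable_module :: "('a, 'r) ring_scheme \<Rightarrow> ('a, 'm) module \<Rightarrow> bool"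
  where "indecomposable_module A M \<longleftrightarrow> \<not> zero_module M \<and>
    (\<forall>U V. internal_direct_sum A M U V \<longrightarrow> U = {\<zero>\<^bsub>M\<^esub>} \<or> V = {\<zero>\<^bsub>M\<^esub>})"

definition direct_summand ::
  "('a, 'r) ring_scheme \<Rightarrow> ('a, 'm) module \<Rightarrow> ('a, 'n) module \<Rightarrow> bool"
  where "direct_summand A X Z \<longleftrightarrow>
    (\<exists>U V. internal_direct_sum A Z U V \<and> mod_iso A X (restrict_module Z U))"


section \<open>Projective and injective modules\<close>

text \<open>
  A definition cannot quantify over all carrier types, so ``all modules'' means all modules with
  carrier in the fixed type \<^typ>\<open>'a list\<close>. No generality is lost: this type is infinite, of
  cardinality \<open>\<kappa> = max |'a| \<aleph>\<^sub>0\<close>, and up to isomorphism it carries exactly the \<open>A\<close>-modules of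
  cardinality at most \<open>\<kappa>\<close>. These include all finitely generated modules and all free modules of
  rank at most \<open>\<kappa>\<close>, they are closed under submodules and quotients, and over a right noetherian
  ring they are closed under injective hulls, because there are at most \<open>\<kappa>\<close> homomorphisms from
  (finitely generated) right ideals into such a module.
\<close>

type_synonym 'a univ_module = "('a, 'a list) module"

definition projective_module :: "('a, 'r) ring_scheme \<Rightarrow> ('a, 'm) module \<Rightarrow> bool"
  where "projective_module A P \<longleftrightarrow> right_module A P \<and>
    (\<forall>(X :: 'a univ_module) (Y :: 'a univ_module). \<forall>g \<in> mod_hom A X Y. \<forall>f \<in> mod_hom A P Y.
      right_module A X \<and> right_module A Y \<and> g ` carrier X = carrier Y \<longrightarrow>
      (\<exists>h \<in> mod_hom A P X. \<forall>x \<in> carrier P. g (h x) = f x))"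

definition injective_module :: "('a, 'r) ring_scheme \<Rightarrow> ('a, 'm) module \<Rightarrow> bool"
  where "injective_module A I \<longleftrightarrow> right_module A I \<and>
    (\<forall>(X :: 'a univ_module) (Y :: 'a univ_module). \<forall>g \<in> mod_hom A X Y. \<forall>f \<in> mod_hom A X I.
      right_module A X \<and> right_module A Y \<and> inj_on g (carrier X) \<longrightarrow>
      (\<exists>h \<in> mod_hom A Y I. \<forall>x \<in> carrier X. h (g x) = f x))"

definition superfluous :: "('a, 'r) ring_scheme \<Rightarrow> ('a, 'm) module \<Rightarrow> 'm set \<Rightarrow> bool"
  where "superfluous A M K \<longleftrightarrow> submodule K A M \<and>
    (\<forall>U. submodule U A M \<and> K <+>\<^bsub>M\<^esub> U = carrier M \<longrightarrow> U = carrier M)"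

definition projective_cover ::
  "('a, 'r) ring_scheme \<Rightarrow> ('a, 'p) module \<Rightarrow> ('p \<Rightarrow> 'm) \<Rightarrow> ('a, 'm) module \<Rightarrow> bool"
  where "projective_cover A P p M \<longleftrightarrow> projective_module A P \<and> p \<in> mod_hom A P M \<and>
    p ` carrier P = carrier M \<and> superfluous A P (a_kernel P M p)"

text \<open>Bass's definition of a semiperfect ring; the property is left-right symmetric.\<close>

definition semiperfect :: "('a, 'r) ring_scheme \<Rightarrow> bool"
  where "semiperfect A \<longleftrightarrow>
    (\<forall>M :: 'a univ_module. fg_module A M \<longrightarrow>
      (\<exists>(P :: 'a univ_module) p. projective_cover A P p M))"


section \<open>Projective resolutions, syzygies and Ext\<close>

text \<open>
  \<open>\<cdots> \<rightarrow> P\<^sub>2 \<rightarrow> P\<^sub>1 \<rightarrow> P\<^sub>0 \<rightarrow> M \<rightarrow> 0\<close> with \<open>pr_diff R i : P\<^bsub>i+1\<^esub> \<rightarrow> P\<^sub>i\<close> and \<open>pr_aug R : P\<^sub>0 \<rightarrow> M\<close>.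
\<close>

record ('a, 'm) proj_res =
  pr_mod :: "nat \<Rightarrow> 'a univ_module"
  pr_diff :: "nat \<Rightarrow> 'a list \<Rightarrow> 'a list"
  pr_aug :: "'a list \<Rightarrow> 'm"

text \<open>
  \<open>pr_kernel M R i\<close> is the kernel of the map out of \<open>P\<^sub>i\<close>, that is, the \<open>(i + 1)\<close>-st syzygy of \<open>M\<close>
  in the resolution.
\<close>

fun pr_kernel :: "('a, 'm) module \<Rightarrow> ('a, 'm) proj_res \<Rightarrow> nat \<Rightarrow> 'a list set"
  where
    "pr_kernel M R 0 = a_kernel (pr_mod R 0) M (pr_aug R)"
  | "pr_kernel M R (Suc i) = a_kernel (pr_mod R (Suc i)) (pr_mod R i) (pr_diff R i)"

abbreviation pr_syzygy :: "('a, 'm) module \<Rightarrow> ('a, 'm) proj_res \<Rightarrow> nat \<Rightarrow> 'a univ_module"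
  where "pr_syzygy M R i \<equiv> restrict_module (pr_mod R i) (pr_kernel M R i)"

definition projective_resolution ::
  "('a, 'r) ring_scheme \<Rightarrow> ('a, 'm) module \<Rightarrow> ('a, 'm) proj_res \<Rightarrow> bool"
  where "projective_resolution A M R \<longleftrightarrow>
    (\<forall>i. fg_module A (pr_mod R i) \<and> projective_module A (pr_mod R i)) \<and>
    pr_aug R \<in> mod_hom A (pr_mod R 0) M \<and>
    (\<forall>i. pr_diff R i \<in> mod_hom A (pr_mod R (Suc i)) (pr_mod R i)) \<and>
    pr_aug R ` carrier (pr_mod R 0) = carrier M \<and>
    (\<forall>i. pr_diff R i ` carrier (pr_mod R (Suc i)) = pr_kernel M R i)"

definition minimal_projective_resolution ::
  "('a, 'r) ring_scheme \<Rightarrow> ('a, 'm) module \<Rightarrow> ('a, 'm) proj_res \<Rightarrow> bool"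
  where "minimal_projective_resolution A M R \<longleftrightarrow> projective_resolution A M R \<and>
    projective_cover A (pr_mod R 0) (pr_aug R) M \<and>
    (\<forall>i. projective_cover A (pr_mod R (Suc i)) (pr_diff R i) (pr_syzygy M R i))"

fun syzygy :: "('a, 'r) ring_scheme \<Rightarrow> nat \<Rightarrow> 'a univ_module \<Rightarrow> 'a univ_module"
  where
    "syzygy A 0 M = M"
  | "syzygy A (Suc i) M = pr_syzygy M (SOME R. minimal_projective_resolution A M R) i"

definition Hom_group ::
  "('a, 'r) ring_scheme \<Rightarrow> ('a, 'm) module \<Rightarrow> ('a, 'n) module \<Rightarrow> ('m \<Rightarrow> 'n) monoid"
  where "Hom_group A M N =
    \<lparr>carrier = mod_hom A M N,
     mult = (\<lambda>f g. \<lambda>x \<in> carrier M. f x \<oplus>\<^bsub>N\<^esub> g x),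
     one = (\<lambda>x \<in> carrier M. \<zero>\<^bsub>N\<^esub>)\<rparr>"

text \<open>Cocycles and coboundaries of the complex \<open>Hom(P\<^sub>0, N) \<rightarrow> Hom(P\<^sub>1, N) \<rightarrow> \<cdots>\<close>.\<close>

definition Ext_cocycles ::
  "('a, 'r) ring_scheme \<Rightarrow> ('a, 'm) proj_res \<Rightarrow> ('a, 'n) module \<Rightarrow> nat \<Rightarrow> ('a list \<Rightarrow> 'n) set"
  where "Ext_cocycles A R N i = {f \<in> mod_hom A (pr_mod R i) N.
    \<forall>x \<in> carrier (pr_mod R (Suc i)). f (pr_diff R i x) = \<zero>\<^bsub>N\<^esub>}"

fun Ext_coboundaries ::
  "('a, 'r) ring_scheme \<Rightarrow> ('a, 'm) proj_res \<Rightarrow> ('a, 'n) module \<Rightarrow> nat \<Rightarrow> ('a list \<Rightarrow> 'n) set"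
  where
    "Ext_coboundaries A R N 0 = {\<lambda>x \<in> carrier (pr_mod R 0). \<zero>\<^bsub>N\<^esub>}"
  | "Ext_coboundaries A R N (Suc i) =
      {compose (carrier (pr_mod R (Suc i))) g (pr_diff R i) |g. g \<in> mod_hom A (pr_mod R i) N}"

text \<open>Up to isomorphism, the Ext group does not depend on the chosen resolution.\<close>

definition Ext ::
  "('a, 'r) ring_scheme \<Rightarrow> nat \<Rightarrow> ('a, 'm) module \<Rightarrow> ('a, 'n) module \<Rightarrow>
    ('a list \<Rightarrow> 'n) set monoid"
  where "Ext A i M N =
    (let R = (SOME R. projective_resolution A M R)
     in (Hom_group A (pr_mod R i) N)\<lparr>carrier := Ext_cocycles A R N i\<rparr> Mod Ext_coboundaries A R N i)"

definition self_orthogonal :: "('a, 'r) ring_scheme \<Rightarrow> ('a, 'm) module \<Rightarrow> bool"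
  where "self_orthogonal A M \<longleftrightarrow> (\<forall>i \<ge> 1. trivial_group (Ext A i M M))"


section \<open>Homological dimensions\<close>

text \<open>An infimum over the empty set is \<open>\<infinity>\<close>; the zero module has dimension \<open>0\<close>.\<close>

definition proj_dim :: "('a, 'r) ring_scheme \<Rightarrow> ('a, 'm) module \<Rightarrow> enat"
  where "proj_dim A M = Inf {enat d |d.
    \<exists>R. projective_resolution A M R \<and> (\<forall>i > d. zero_module (pr_mod R i))}"

text \<open>
  \<open>0 \<rightarrow> M \<rightarrow> I\<^sub>0 \<rightarrow> I\<^sub>1 \<rightarrow> \<cdots>\<close> with \<open>ir_coaug R : M \<rightarrow> I\<^sub>0\<close> and \<open>ir_diff R i : I\<^sub>i \<rightarrow> I\<^bsub>i+1\<^esub>\<close>.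
  The modules \<open>I\<^sub>i\<close> need not be finitely generated.
\<close>

record ('a, 'm) inj_res =
  ir_mod :: "nat \<Rightarrow> 'a univ_module"
  ir_diff :: "nat \<Rightarrow> 'a list \<Rightarrow> 'a list"
  ir_coaug :: "'m \<Rightarrow> 'a list"

definition injective_resolution ::
  "('a, 'r) ring_scheme \<Rightarrow> ('a, 'm) module \<Rightarrow> ('a, 'm) inj_res \<Rightarrow> bool"
  where "injective_resolution A M R \<longleftrightarrow>
    (\<forall>i. injective_module A (ir_mod R i)) \<and>
    ir_coaug R \<in> mod_hom A M (ir_mod R 0) \<and>
    (\<forall>i. ir_diff R i \<in> mod_hom A (ir_mod R i) (ir_mod R (Suc i))) \<and>
    inj_on (ir_coaug R) (carrier M) \<and>
    ir_coaug R ` carrier M = a_kernel (ir_mod R 0) (ir_mod R 1) (ir_diff R 0) \<and>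
    (\<forall>i. ir_diff R i ` carrier (ir_mod R i) =
      a_kernel (ir_mod R (Suc i)) (ir_mod R (Suc (Suc i))) (ir_diff R (Suc i)))"

definition inj_dim :: "('a, 'r) ring_scheme \<Rightarrow> ('a, 'm) module \<Rightarrow> enat"
  where "inj_dim A M = Inf {enat d |d.
    \<exists>R. injective_resolution A M R \<and> (\<forall>i > d. zero_module (ir_mod R i))}"


section \<open>Iwanaga-Gorenstein rings\<close>

definition iwanaga_gorenstein :: "nat \<Rightarrow> ('a, 'r) ring_scheme \<Rightarrow> bool"
  where "iwanaga_gorenstein n A \<longleftrightarrow>
    inj_dim A (regular_module A) = enat n \<and>
    inj_dim (opposite_ring A) (regular_module (opposite_ring A)) = enat n"

text \<open>Maximal Cohen-Macaulay modules over an \<open>n\<close>-Iwanaga-Gorenstein ring.\<close>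

definition CM :: "nat \<Rightarrow> ('a, 'r) ring_scheme \<Rightarrow> 'a univ_module set"
  where "CM n A = {X. fg_module A X \<and>
    (projective_module A X \<or> (\<exists>N. fg_module A N \<and> direct_summand A X (syzygy A n N)))}"

definition periodic :: "('a, 'r) ring_scheme \<Rightarrow> 'a univ_module \<Rightarrow> bool"
  where "periodic A X \<longleftrightarrow> (\<exists>l \<ge> 1. mod_iso A (syzygy A l X) X)"

end

(*
  Ext^i(M, M) = 0 for all i > n, together with Ext^i(-, P) = 0 for P projective and i > n + 1, shifts in
  both variables to Ext^i(Z, Z) = 0 for all i > n, where Z is the n-th syzygy of M. If Z is not
  projective, noetherianity gives an indecomposable non-projective summand V of Z; it is
  Cohen-Macaulay, hence periodic, and Ext^i(V, V) = 0 for i > n. For a period l and k l > n, vanishing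
  of Ext^(k l)(V, V) says that the isomorphism from the (k l)-th syzygy of V onto V extends to a
  projective module, so V is projective, a contradiction. Hence Z is projective.

  Syzygies with respect to different resolutions are compared by stable retractions: maps f, g such
  that g f differs from the identity by a map through a projective module. These pass to syzygies
  under arbitrary projective covers and transport the vanishing of Ext, which replaces Schanuel's
  lemma and the comparison theorem.
*)
theory Submission
  imports Defs
begin

text \<open>The obstacle is that \<open>Ext\<close> and \<open>syzygy\<close> each pick a resolution
  by \<open>SOME\<close>, one arbitrary and one minimal, so that facts about one must be read off
  another. Hence Ext is unpacked as a quotient group only once: degree u + 1 vanishes exactly when
  every homomorphism from the (u + 1)-st syzygy extends to the projective module in degree u. This
  extension property, for an explicit resolution, is what gets shifted, restricted to summands and
  moved between resolutions. A multiple k l of the period is taken because vanishing is known only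
  in degrees above n, while l may be small. The summand V comes from a complement chosen maximal, so
  a single V suffices and no Krull-Schmidt decomposition is built. A further constraint is typing:
  \<open>syzygy\<close>, \<open>CM\<close> and \<open>periodic\<close> speak of modules on lists,
  whereas \<open>M\<close> lives on any type; it is therefore replaced by an isomorphic copy on
  coefficient lists.\<close>

section \<open>Right modules and their homomorphisms\<close>

text \<open>The library notion asks for an additive subgroup, hence for closure under negation. This
  comes from the scalar action, since the negative of x is x acted on by minus one.\<close>

lemma submodule_iff:
  assumes "right_module A M"
  shows "submodule U A M \<longleftrightarrow> U \<subseteq> carrier M \<and> \<zero>\<^bsub>M\<^esub> \<in> U \<and>
    (\<forall>x\<in>U. \<forall>y\<in>U. x \<oplus>\<^bsub>M\<^esub> y \<in> U) \<and> (\<forall>a\<in>carrier A. \<forall>x\<in>U. a \<odot>\<^bsub>M\<^esub> x \<in> U)" (is "?L \<longleftrightarrow> ?R")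
proof
  assume ?L
  then interpret submodule U A M .
  show ?R using subset m_closed one_closed smult_closed by auto
next
  assume R: ?R
  interpret M: right_module A M by fact
  have neg: "\<ominus>\<^bsub>M\<^esub> x \<in> U" if "x \<in> U" for x
  proof -
    have x: "x \<in> carrier M" using R that by auto
    have "(\<ominus>\<^bsub>A\<^esub> \<one>\<^bsub>A\<^esub> \<oplus>\<^bsub>A\<^esub> \<one>\<^bsub>A\<^esub>) \<odot>\<^bsub>M\<^esub> x = (\<ominus>\<^bsub>A\<^esub> \<one>\<^bsub>A\<^esub>) \<odot>\<^bsub>M\<^esub> x \<oplus>\<^bsub>M\<^esub> x"
      using x by (simp add: M.act_add_scalar M.act_one del: M.R.add.l_inv)
    moreover have "\<zero>\<^bsub>A\<^esub> \<odot>\<^bsub>M\<^esub> x = \<zero>\<^bsub>M\<^esub>"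
    proof -
      have "\<zero>\<^bsub>A\<^esub> \<odot>\<^bsub>M\<^esub> x \<oplus>\<^bsub>M\<^esub> \<zero>\<^bsub>A\<^esub> \<odot>\<^bsub>M\<^esub> x = \<zero>\<^bsub>A\<^esub> \<odot>\<^bsub>M\<^esub> x"
        using x M.act_add_scalar[of "\<zero>\<^bsub>A\<^esub>" "\<zero>\<^bsub>A\<^esub>" x] by simp
      then show ?thesis using x M.act_closed[of "\<zero>\<^bsub>A\<^esub>" x]
        by (simp)
    qed
    ultimately have "(\<ominus>\<^bsub>A\<^esub> \<one>\<^bsub>A\<^esub>) \<odot>\<^bsub>M\<^esub> x \<oplus>\<^bsub>M\<^esub> x = \<zero>\<^bsub>M\<^esub>"
      by (simp add: M.R.l_neg)
    then have "\<ominus>\<^bsub>M\<^esub> x = (\<ominus>\<^bsub>A\<^esub> \<one>\<^bsub>A\<^esub>) \<odot>\<^bsub>M\<^esub> x"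
      using x M.act_closed[of "\<ominus>\<^bsub>A\<^esub> \<one>\<^bsub>A\<^esub>" x] M.M.minus_equality by simp
    then show ?thesis using R that by simp
  qed
  show ?L
    by (intro submodule.intro subgroup.intro submodule_axioms.intro)
       (use R neg in \<open>auto simp: a_inv_def\<close>)
qed

lemma right_module_ring: "right_module A M \<Longrightarrow> ring A"
  by (simp add: right_module_def)

lemma right_module_abelian_group: "right_module A M \<Longrightarrow> abelian_group M"
  by (simp add: right_module_def)

lemma minus_eq_zeroD:
  assumes "abelian_group M" "x \<ominus>\<^bsub>M\<^esub> y = \<zero>\<^bsub>M\<^esub>" "x \<in> carrier M" "y \<in> carrier M"
  shows "x = y"
proof -
  interpret abelian_group M by fact
  show ?thesis using assms(2-4) minus_equality[of x "\<ominus>\<^bsub>M\<^esub> y"] by (simp add: a_minus_def)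
qed

context
  fixes A :: "('a, 'r) ring_scheme" and M :: "('a, 'm) module" and U
  assumes U: "submodule U A M" and M: "right_module A M"
begin

interpretation M: right_module A M by (fact M)
interpretation U: submodule U A M by (fact U)

lemma submodule_subset: "U \<subseteq> carrier M"
  using U.subset by simp

lemma submodule_carrier: "x \<in> U \<Longrightarrow> x \<in> carrier M"
  using submodule_subset by blast

lemma submodule_zero: "\<zero>\<^bsub>M\<^esub> \<in> U"
  using U.one_closed by simp

lemma submodule_add: "x \<in> U \<Longrightarrow> y \<in> U \<Longrightarrow> x \<oplus>\<^bsub>M\<^esub> y \<in> U"
  using U.m_closed by simp

lemma submodule_smult: "a \<in> carrier A \<Longrightarrow> x \<in> U \<Longrightarrow> a \<odot>\<^bsub>M\<^esub> x \<in> U"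
  by simp

lemma submodule_neg: "x \<in> U \<Longrightarrow> \<ominus>\<^bsub>M\<^esub> x \<in> U"
  using U.m_inv_closed by (simp add: a_inv_def)

lemma submodule_minus: "x \<in> U \<Longrightarrow> y \<in> U \<Longrightarrow> x \<ominus>\<^bsub>M\<^esub> y \<in> U"
  by (simp add: a_minus_def submodule_neg submodule_add)

lemma right_module_restrict: "right_module A (restrict_module M U)"
proof (intro right_module.intro right_module_axioms.intro)
  show "abelian_group (restrict_module M U)"
    by (rule abelian_groupI)
       (auto simp: submodule_add submodule_zero submodule_carrier M.M.a_ac M.M.r_neg
         intro!: bexI[of _ "\<ominus>\<^bsub>M\<^esub> _"] submodule_neg)
qed (auto simp: M.R.ring_axioms submodule_carrier M.act_add_scalar M.act_add M.act_mult M.act_one)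

end

lemma submodule_restrict_iff:
  assumes "submodule U A M" "right_module A M"
  shows "submodule T A (restrict_module M U) \<longleftrightarrow> submodule T A M \<and> T \<subseteq> U"
  using submodule_iff[OF right_module_restrict[OF assms]] submodule_iff[OF assms(2)]
    submodule_subset[OF assms] by auto

lemma submodule_carrier_self: "right_module A M \<Longrightarrow> submodule (carrier M) A M"
  unfolding submodule_iff
  by (auto simp: right_module.act_closed abelian_groupE[OF right_module_abelian_group])

lemma submodule_zero_self: "right_module A M \<Longrightarrow> submodule {\<zero>\<^bsub>M\<^esub>} A M"
proof -
  assume M: "right_module A M"
  interpret M: right_module A M by fact
  have "a \<odot>\<^bsub>M\<^esub> \<zero>\<^bsub>M\<^esub> = \<zero>\<^bsub>M\<^esub>" if "a \<in> carrier A" for a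
  proof -
    have "a \<odot>\<^bsub>M\<^esub> \<zero>\<^bsub>M\<^esub> \<oplus>\<^bsub>M\<^esub> a \<odot>\<^bsub>M\<^esub> \<zero>\<^bsub>M\<^esub> = a \<odot>\<^bsub>M\<^esub> \<zero>\<^bsub>M\<^esub>"
      using that M.act_add[of a "\<zero>\<^bsub>M\<^esub>" "\<zero>\<^bsub>M\<^esub>"] by simp
    then show ?thesis using that M.act_closed[of a "\<zero>\<^bsub>M\<^esub>"] by simp
  qed
  then show ?thesis using submodule_iff[OF M] by simp
qed

lemma submodule_Int:
  "submodule U A M \<Longrightarrow> submodule V A M \<Longrightarrow> right_module A M \<Longrightarrow> submodule (U \<inter> V) A M"
  by (auto simp: submodule_iff)

lemma smult_zero_right: "right_module A M \<Longrightarrow> a \<in> carrier A \<Longrightarrow> a \<odot>\<^bsub>M\<^esub> \<zero>\<^bsub>M\<^esub> = \<zero>\<^bsub>M\<^esub>"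
  using submodule_zero_self submodule_iff by fastforce

lemma smult_neg:
  assumes "right_module A M" "a \<in> carrier A" "x \<in> carrier M"
  shows "a \<odot>\<^bsub>M\<^esub> (\<ominus>\<^bsub>M\<^esub> x) = \<ominus>\<^bsub>M\<^esub> (a \<odot>\<^bsub>M\<^esub> x)"
proof -
  interpret M: right_module A M by fact
  have "a \<odot>\<^bsub>M\<^esub> (\<ominus>\<^bsub>M\<^esub> x) \<oplus>\<^bsub>M\<^esub> a \<odot>\<^bsub>M\<^esub> x = \<zero>\<^bsub>M\<^esub>"
    using assms M.act_add[of a "\<ominus>\<^bsub>M\<^esub> x" x] by (simp add: M.l_neg smult_zero_right)
  then show ?thesis using assms M.act_closed M.M.minus_equality by fastforce
qed

lemma mod_homI:
  assumes "\<And>x. x \<in> carrier M \<Longrightarrow> f x \<in> carrier N"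
    and "f \<in> extensional (carrier M)"
    and "\<And>x y. x \<in> carrier M \<Longrightarrow> y \<in> carrier M \<Longrightarrow> f (x \<oplus>\<^bsub>M\<^esub> y) = f x \<oplus>\<^bsub>N\<^esub> f y"
    and "\<And>a x. a \<in> carrier A \<Longrightarrow> x \<in> carrier M \<Longrightarrow> f (a \<odot>\<^bsub>M\<^esub> x) = a \<odot>\<^bsub>N\<^esub> f x"
  shows "f \<in> mod_hom A M N"
  using assms by (auto simp: mod_hom_def PiE_def)

lemma mod_hom_restrictI:
  assumes "right_module A M"
    and "\<And>x. x \<in> carrier M \<Longrightarrow> f x \<in> carrier N"
    and "\<And>x y. x \<in> carrier M \<Longrightarrow> y \<in> carrier M \<Longrightarrow> f (x \<oplus>\<^bsub>M\<^esub> y) = f x \<oplus>\<^bsub>N\<^esub> f y"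
    and "\<And>a x. a \<in> carrier A \<Longrightarrow> x \<in> carrier M \<Longrightarrow> f (a \<odot>\<^bsub>M\<^esub> x) = a \<odot>\<^bsub>N\<^esub> f x"
  shows "restrict f (carrier M) \<in> mod_hom A M N"
proof -
  interpret M: right_module A M by fact
  show ?thesis by (rule mod_homI) (use assms M.act_closed in auto)
qed

lemma mod_hom_closed: "f \<in> mod_hom A M N \<Longrightarrow> x \<in> carrier M \<Longrightarrow> f x \<in> carrier N"
  and mod_hom_add: "f \<in> mod_hom A M N \<Longrightarrow> x \<in> carrier M \<Longrightarrow> y \<in> carrier M \<Longrightarrow>
    f (x \<oplus>\<^bsub>M\<^esub> y) = f x \<oplus>\<^bsub>N\<^esub> f y"
  and mod_hom_smult: "f \<in> mod_hom A M N \<Longrightarrow> a \<in> carrier A \<Longrightarrow> x \<in> carrier M \<Longrightarrow>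
    f (a \<odot>\<^bsub>M\<^esub> x) = a \<odot>\<^bsub>N\<^esub> f x"
  and mod_hom_ext: "f \<in> mod_hom A M N \<Longrightarrow> f \<in> extensional (carrier M)"
  by (auto simp: mod_hom_def PiE_def)

lemma mod_hom_zero:
  assumes "f \<in> mod_hom A M N" "right_module A M" "right_module A N"
  shows "f \<zero>\<^bsub>M\<^esub> = \<zero>\<^bsub>N\<^esub>"
proof -
  interpret M: right_module A M by fact
  interpret N: right_module A N by fact
  have "f \<zero>\<^bsub>M\<^esub> \<oplus>\<^bsub>N\<^esub> f \<zero>\<^bsub>M\<^esub> = f \<zero>\<^bsub>M\<^esub>"
    using mod_hom_add[OF assms(1), of "\<zero>\<^bsub>M\<^esub>" "\<zero>\<^bsub>M\<^esub>"] by simp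
  then show ?thesis using mod_hom_closed[OF assms(1), of "\<zero>\<^bsub>M\<^esub>"] by simp
qed

lemma mod_hom_neg:
  assumes "f \<in> mod_hom A M N" "right_module A M" "right_module A N" "x \<in> carrier M"
  shows "f (\<ominus>\<^bsub>M\<^esub> x) = \<ominus>\<^bsub>N\<^esub> f x"
proof -
  interpret M: right_module A M by fact
  interpret N: right_module A N by fact
  have "f (\<ominus>\<^bsub>M\<^esub> x) \<oplus>\<^bsub>N\<^esub> f x = \<zero>\<^bsub>N\<^esub>"
    using mod_hom_add[OF assms(1), of "\<ominus>\<^bsub>M\<^esub> x" x] assms mod_hom_zero[OF assms(1-3)]
    by (simp add: M.l_neg)
  then show ?thesis using mod_hom_closed[OF assms(1)] assms(4) N.M.minus_equality by simp
qed

lemma mod_hom_minus: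
  assumes "f \<in> mod_hom A M N" "right_module A M" "right_module A N" "x \<in> carrier M" "y \<in> carrier M"
  shows "f (x \<ominus>\<^bsub>M\<^esub> y) = f x \<ominus>\<^bsub>N\<^esub> f y"
proof -
  interpret M: right_module A M by fact
  show ?thesis using assms mod_hom_add[OF assms(1)] mod_hom_neg[OF assms(1-3)]
    by (simp add: a_minus_def)
qed

lemma mod_hom_compose:
  assumes "f \<in> mod_hom A M N" "g \<in> mod_hom A N L" "right_module A M"
  shows "compose (carrier M) g f \<in> mod_hom A M L"
  unfolding compose_def
  by (rule mod_hom_restrictI[OF assms(3)])
     (auto simp: mod_hom_closed[OF assms(1)] mod_hom_closed[OF assms(2)] mod_hom_add[OF assms(1)]
       mod_hom_add[OF assms(2)] mod_hom_smult[OF assms(1)] mod_hom_smult[OF assms(2)])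

lemma mod_hom_diff:
  assumes "f \<in> mod_hom A M N" "g \<in> mod_hom A M N" "right_module A M" "right_module A N"
  shows "(\<lambda>x\<in>carrier M. f x \<ominus>\<^bsub>N\<^esub> g x) \<in> mod_hom A M N"
proof -
  interpret N: right_module A N by fact
  show ?thesis
  proof (rule mod_hom_restrictI[OF assms(3)])
    fix x y assume xy: "x \<in> carrier M" "y \<in> carrier M"
    then show "f (x \<oplus>\<^bsub>M\<^esub> y) \<ominus>\<^bsub>N\<^esub> g (x \<oplus>\<^bsub>M\<^esub> y) = f x \<ominus>\<^bsub>N\<^esub> g x \<oplus>\<^bsub>N\<^esub> (f y \<ominus>\<^bsub>N\<^esub> g y)"
      by (simp add: mod_hom_closed[OF assms(1)] mod_hom_closed[OF assms(2)] mod_hom_add[OF assms(1)]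
       mod_hom_add[OF assms(2)] a_minus_def N.M.minus_add N.M.a_ac)
  qed (simp_all add: mod_hom_closed[OF assms(1)] mod_hom_closed[OF assms(2)] mod_hom_smult[OF assms(1)]
      mod_hom_smult[OF assms(2)] a_minus_def N.act_add N.act_closed smult_neg[OF assms(4)])
qed

lemma mod_hom_sum:
  assumes "f \<in> mod_hom A M N" "g \<in> mod_hom A M N" "right_module A M" "right_module A N"
  shows "(\<lambda>x\<in>carrier M. f x \<oplus>\<^bsub>N\<^esub> g x) \<in> mod_hom A M N"
proof -
  interpret N: right_module A N by fact
  show ?thesis
    by (rule mod_hom_restrictI[OF assms(3)])
      (simp_all add: mod_hom_closed[OF assms(1)] mod_hom_closed[OF assms(2)] mod_hom_smult[OF assms(1)]
      mod_hom_smult[OF assms(2)] mod_hom_add[OF assms(1)] mod_hom_add[OF assms(2)]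
       N.act_add N.act_closed N.M.a_ac)
qed

lemma mod_hom_const_zero:
  assumes "right_module A M" "right_module A N"
  shows "(\<lambda>x\<in>carrier M. \<zero>\<^bsub>N\<^esub>) \<in> mod_hom A M N"
proof -
  interpret N: right_module A N by fact
  show ?thesis by (rule mod_hom_restrictI[OF assms(1)]) (simp_all add: smult_zero_right[OF assms(2)])
qed

lemma mod_hom_id:
  assumes "right_module A M"
  shows "(\<lambda>x\<in>carrier M. x) \<in> mod_hom A M M"
  by (rule mod_hom_restrictI[OF assms(1)]) simp_all

lemma mod_hom_incl:
  assumes "right_module A M" "submodule U A M"
  shows "(\<lambda>x\<in>U. x) \<in> mod_hom A (restrict_module M U) M"
  using mod_hom_restrictI[OF right_module_restrict[OF assms(2,1)], of "\<lambda>x. x" M]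
    submodule_carrier[OF assms(2,1)] by simp

lemma mod_hom_restrict:
  assumes "f \<in> mod_hom A M N" "right_module A M" "submodule U A M"
  shows "restrict f U \<in> mod_hom A (restrict_module M U) N"
  using mod_hom_restrictI[OF right_module_restrict[OF assms(3,2)], of f N]
    submodule_carrier[OF assms(3,2)] mod_hom_closed[OF assms(1)] mod_hom_add[OF assms(1)]
    mod_hom_smult[OF assms(1)] by simp

lemma mod_hom_corestrict:
  assumes "f \<in> mod_hom A M N" "\<And>x. x \<in> carrier M \<Longrightarrow> f x \<in> U"
  shows "f \<in> mod_hom A M (restrict_module N U)"
  using assms by (auto simp: mod_hom_def PiE_def)

lemma mod_hom_uncorestrict:
  assumes "f \<in> mod_hom A M (restrict_module N U)" "U \<subseteq> carrier N"
  shows "f \<in> mod_hom A M N"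
  using assms by (auto simp: mod_hom_def PiE_def)

lemma submodule_kernel:
  assumes "f \<in> mod_hom A M N" "right_module A M" "right_module A N"
  shows "submodule (a_kernel M N f) A M"
proof -
  interpret M: right_module A M by fact
  interpret N: right_module A N by fact
  show ?thesis unfolding submodule_iff[OF assms(2)] a_kernel_def'
    by (auto simp: mod_hom_add[OF assms(1)] mod_hom_smult[OF assms(1)] mod_hom_zero[OF assms]
      M.act_closed smult_zero_right[OF assms(3)])
qed

text \<open>A homomorphism that kills the kernel of a surjection is constant on its fibres, so it
  may be evaluated at arbitrarily chosen preimages.\<close>

lemma mod_hom_factor:
  assumes p: "p \<in> mod_hom A P W" "p ` carrier P = carrier W"
    and h: "h \<in> mod_hom A P V" and k: "\<And>x. x \<in> carrier P \<Longrightarrow> p x = \<zero>\<^bsub>W\<^esub> \<Longrightarrow> h x = \<zero>\<^bsub>V\<^esub>"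
    and m: "right_module A P" "right_module A W" "right_module A V"
  obtains g where "g \<in> mod_hom A W V" "\<And>x. x \<in> carrier P \<Longrightarrow> g (p x) = h x"
proof -
  interpret P: right_module A P by fact
  interpret W: right_module A W by fact
  interpret V: right_module A V by fact
  have eq: "h x = h y" if "x \<in> carrier P" "y \<in> carrier P" "p x = p y" for x y
  proof -
    have "p (x \<ominus>\<^bsub>P\<^esub> y) = \<zero>\<^bsub>W\<^esub>"
      using that mod_hom_closed[OF p(1) that(2)] W.M.r_neg
      by (simp add: mod_hom_minus[OF p(1) m(1,2)] a_minus_def[of W])
    then have "h x \<ominus>\<^bsub>V\<^esub> h y = \<zero>\<^bsub>V\<^esub>"
      using k[of "x \<ominus>\<^bsub>P\<^esub> y"] that by (simp add: mod_hom_minus[OF h m(1,3)])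
    then show ?thesis using that mod_hom_closed[OF h] minus_eq_zeroD[OF right_module_abelian_group[OF m(3)]] by simp
  qed
  \<comment> \<open>Only a set-theoretic section of \<open>p\<close>. Linearity of \<open>g\<close>
    comes from \<open>eq\<close>, which makes the choice of preimage irrelevant.\<close>
  define r where "r w = (SOME x. x \<in> carrier P \<and> p x = w)" for w
  have r: "r w \<in> carrier P \<and> p (r w) = w" if "w \<in> carrier W" for w
    unfolding r_def by (rule someI_ex) (use that p(2)[symmetric] in auto)
  define g where "g = (\<lambda>w\<in>carrier W. h (r w))"
  have gp: "g (p x) = h x" if "x \<in> carrier P" for x
    using that r[of "p x"] mod_hom_closed[OF p(1) that] by (auto simp: g_def intro: eq)
  have "g \<in> mod_hom A W V" unfolding g_def
  proof (rule mod_hom_restrictI[OF m(2)])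
    fix x y assume xy: "x \<in> carrier W" "y \<in> carrier W"
    have "h (r (x \<oplus>\<^bsub>W\<^esub> y)) = h (r x \<oplus>\<^bsub>P\<^esub> r y)"
      using xy r[of x] r[of y] r[of "x \<oplus>\<^bsub>W\<^esub> y"] by (intro eq) (auto simp: mod_hom_add[OF p(1)])
    then show "h (r (x \<oplus>\<^bsub>W\<^esub> y)) = h (r x) \<oplus>\<^bsub>V\<^esub> h (r y)"
      using xy r by (simp add: mod_hom_add[OF h])
  next
    fix a x assume xy: "a \<in> carrier A" "x \<in> carrier W"
    have "h (r (a \<odot>\<^bsub>W\<^esub> x)) = h (a \<odot>\<^bsub>P\<^esub> r x)"
      using xy r[of x] r[of "a \<odot>\<^bsub>W\<^esub> x"] W.act_closed P.act_closed
      by (intro eq) (auto simp: mod_hom_smult[OF p(1)])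
    then show "h (r (a \<odot>\<^bsub>W\<^esub> x)) = a \<odot>\<^bsub>V\<^esub> h (r x)"
      using xy r by (simp add: mod_hom_smult[OF h])
  qed (use r mod_hom_closed[OF h] in auto)
  then show thesis using gp that by blast
qed

lemma mod_iso_sym:
  assumes "mod_iso A M N" "right_module A M" "right_module A N"
  obtains f g where "f \<in> mod_hom A M N" "g \<in> mod_hom A N M"
    "\<And>x. x \<in> carrier M \<Longrightarrow> g (f x) = x" "\<And>y. y \<in> carrier N \<Longrightarrow> f (g y) = y"
proof -
  obtain f where f: "f \<in> mod_hom A M N" "bij_betw f (carrier M) (carrier N)"
    using assms by (auto simp: mod_iso_def)
  interpret M: right_module A M by fact
  interpret N: right_module A N by fact
  have im: "f ` carrier M = carrier N" and inj: "inj_on f (carrier M)"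
    using f(2) by (auto simp: bij_betw_def)
  obtain g where g: "g \<in> mod_hom A N M"
    "\<And>x. x \<in> carrier M \<Longrightarrow> g (f x) = (\<lambda>x\<in>carrier M. x) x"
  proof (rule mod_hom_factor[OF f(1) im mod_hom_id[OF assms(2)] _ assms(2,3,2)])
    fix x assume "x \<in> carrier M" "f x = \<zero>\<^bsub>N\<^esub>"
    then show "(\<lambda>x\<in>carrier M. x) x = \<zero>\<^bsub>M\<^esub>"
      using inj_onD[OF inj, of x "\<zero>\<^bsub>M\<^esub>"] mod_hom_zero[OF f(1) assms(2,3)] by simp
  qed blast
  show thesis
  proof (rule that[OF f(1) g(1)])
    show "f (g y) = y" if "y \<in> carrier N" for y
      using that g(2) unfolding im[symmetric] by auto
  qed (use g(2) in simp)
qed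

lemma projectiveD:
  fixes X Y :: "'a univ_module"
  assumes "projective_module A P" "g \<in> mod_hom A X Y" "g ` carrier X = carrier Y" "f \<in> mod_hom A P Y"
    "right_module A X" "right_module A Y"
  obtains h where "h \<in> mod_hom A P X" "\<And>x. x \<in> carrier P \<Longrightarrow> g (h x) = f x"
proof -
  from assms(1)[unfolded projective_module_def, THEN conjunct2, rule_format, OF assms(2,4)]
  show ?thesis using assms(3,5,6) that by auto
qed

lemma projective_right_module: "projective_module A P \<Longrightarrow> right_module A P"
  by (simp add: projective_module_def)

lemma fg_right_module: "fg_module A P \<Longrightarrow> right_module A P"
  by (simp add: fg_module_def)

section \<open>Resolutions, vanishing of Ext and stable retracts\<close>

text \<open>Dual to \<open>mod_hom_factor\<close>: injectivity of \<open>j\<close> lets every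
  identity in \<open>W\<close> be checked after applying \<open>j\<close>, where it becomes an
  identity for \<open>h\<close>.\<close>

lemma mod_hom_lift_inj:
  assumes j: "j \<in> mod_hom A W I" "inj_on j (carrier W)"
    and h: "h \<in> mod_hom A P I" "\<And>x. x \<in> carrier P \<Longrightarrow> h x \<in> j ` carrier W"
    and m: "right_module A P" "right_module A W"
  obtains g where "g \<in> mod_hom A P W" "\<And>x. x \<in> carrier P \<Longrightarrow> j (g x) = h x"
proof -
  interpret P: right_module A P by fact
  interpret W: right_module A W by fact
  define g where "g = (\<lambda>x\<in>carrier P. the_inv_into (carrier W) j (h x))"
  have g: "g x \<in> carrier W" "j (g x) = h x" if "x \<in> carrier P" for x
    using that h(2)[OF that] j(2) by (auto simp: g_def f_the_inv_into_f intro: the_inv_into_into)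
  have eq: "a = b" if "a \<in> carrier W" "b \<in> carrier W" "j a = j b" for a b
    using that j(2) by (auto dest: inj_onD)
  have "g \<in> mod_hom A P W"
  proof (rule mod_homI)
    show "g (x \<oplus>\<^bsub>P\<^esub> y) = g x \<oplus>\<^bsub>W\<^esub> g y" if "x \<in> carrier P" "y \<in> carrier P" for x y
      using that g by (intro eq) (auto simp: mod_hom_add[OF j(1)] mod_hom_add[OF h(1)])
    show "g (a \<odot>\<^bsub>P\<^esub> x) = a \<odot>\<^bsub>W\<^esub> g x" if "a \<in> carrier A" "x \<in> carrier P" for a x
      using that g P.act_closed W.act_closed
      by (intro eq) (auto simp: mod_hom_smult[OF j(1)] mod_hom_smult[OF h(1)])
  qed (use g in \<open>auto simp: g_def\<close>)
  then show thesis using g that by blast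
qed

text \<open>Prepends the module itself as the syzygy of index 0. Together with
  \<open>res_map\<close>, which prepends the augmentation to the differentials, every index u then
  has the same form: \<open>pr_mod R u\<close> maps onto the syzygy of index u with the next syzygy
  as kernel.\<close>

fun res_syz :: "'a univ_module \<Rightarrow> ('a, 'a list) proj_res \<Rightarrow> nat \<Rightarrow> 'a univ_module"
  where
    "res_syz X R 0 = X"
  | "res_syz X R (Suc i) = pr_syzygy X R i"

fun res_map :: "('a, 'a list) proj_res \<Rightarrow> nat \<Rightarrow> 'a list \<Rightarrow> 'a list"
  where
    "res_map R 0 = pr_aug R"
  | "res_map R (Suc i) = pr_diff R i"

context
  fixes A :: "('a, 'r) ring_scheme" and X :: "'a univ_module" and R
  assumes X: "right_module A X" and R: "projective_resolution A X R"
begin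

lemma res_fg: "fg_module A (pr_mod R u)"
  and res_projective: "projective_module A (pr_mod R u)"
  using R by (simp_all add: projective_resolution_def)

lemma res_right_module: "right_module A (pr_mod R u)"
  by (rule projective_right_module[OF res_projective])

text \<open>Holds uniformly because \<open>restrict_module\<close> keeps the zero of the ambient
  module, so cutting the codomain down to a syzygy does not change the kernel.\<close>

lemma res_syz_Suc:
  "res_syz X R (Suc u) = restrict_module (pr_mod R u) (a_kernel (pr_mod R u) (res_syz X R u) (res_map R u))"
  by (cases u) (simp_all add: a_kernel_def')

lemma res_syz_map:
  shows res_syz_right_module: "right_module A (res_syz X R u)"
    and res_map_hom: "res_map R u \<in> mod_hom A (pr_mod R u) (res_syz X R u)"
    and res_map_surj: "res_map R u ` carrier (pr_mod R u) = carrier (res_syz X R u)"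
proof (induction u)
  case 0
  { case 1 show ?case by (simp add: X) }
  { case 2 show ?case using R by (simp add: projective_resolution_def) }
  { case 3 show ?case using R by (simp add: projective_resolution_def) }
next
  case (Suc u)
  have m: "right_module A (res_syz X R (Suc u))"
    unfolding res_syz_Suc
    by (intro right_module_restrict submodule_kernel Suc res_right_module)
  have s: "res_map R (Suc u) ` carrier (pr_mod R (Suc u)) = carrier (res_syz X R (Suc u))"
    using R by (simp add: projective_resolution_def)
  { case 1 show ?case by (rule m) }
  { case 2
    have "pr_diff R u \<in> mod_hom A (pr_mod R (Suc u)) (pr_mod R u)"
      using R by (simp add: projective_resolution_def)
    then show ?case using s by (auto intro: mod_hom_corestrict) }
  { case 3 show ?case by (rule s) }
qed

lemma res_kernel_submodule:
  "submodule (a_kernel (pr_mod R u) (res_syz X R u) (res_map R u)) A (pr_mod R u)"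
  by (intro submodule_kernel res_syz_map res_right_module)

lemma carrier_res_syz_Suc:
  "x \<in> carrier (res_syz X R (Suc u)) \<longleftrightarrow> x \<in> carrier (pr_mod R u) \<and> res_map R u x = \<zero>\<^bsub>res_syz X R u\<^esub>"
  by (simp add: res_syz_Suc a_kernel_def' del: res_syz.simps(2))

lemma res_map_hom_pr_mod: "res_map R (Suc u) \<in> mod_hom A (pr_mod R (Suc u)) (pr_mod R u)"
  using res_map_hom[of "Suc u"] unfolding res_syz_Suc
  by (rule mod_hom_uncorestrict) (auto simp: a_kernel_def')

end

text \<open>Index shift: \<open>ext_vanish A X R u Y\<close> expresses the vanishing of \<open>Ext\<^sup>i(X, Y)\<close> for \<open>i = u + 1\<close>.\<close>

definition ext_vanish ::
  "('a, 'r) ring_scheme \<Rightarrow> 'a univ_module \<Rightarrow> ('a, 'a list) proj_res \<Rightarrow> nat \<Rightarrow> ('a, 'n) module \<Rightarrow> bool"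
  where "ext_vanish A X R u Y \<longleftrightarrow> (\<forall>g \<in> mod_hom A (res_syz X R (Suc u)) Y.
    \<exists>h \<in> mod_hom A (pr_mod R u) Y. \<forall>x \<in> carrier (res_syz X R (Suc u)). h x = g x)"

lemma ext_vanishD:
  assumes "ext_vanish A X R u Y" "g \<in> mod_hom A (res_syz X R (Suc u)) Y"
  obtains h where "h \<in> mod_hom A (pr_mod R u) Y"
    "\<And>x. x \<in> carrier (res_syz X R (Suc u)) \<Longrightarrow> h x = g x"
  using assms unfolding ext_vanish_def by blast

lemma ext_vanishI:
  assumes "\<And>g. g \<in> mod_hom A (res_syz X R (Suc u)) Y \<Longrightarrow>
    \<exists>h \<in> mod_hom A (pr_mod R u) Y. \<forall>x \<in> carrier (res_syz X R (Suc u)). h x = g x"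
  shows "ext_vanish A X R u Y"
  using assms unfolding ext_vanish_def by blast

text \<open>Extend \<open>a\<close> after \<open>g\<close> with values in \<open>Z\<close> and
  return by \<open>b\<close>; on the syzygy \<open>b\<close> undoes \<open>a\<close>.\<close>

lemma ext_vanish_retract:
  assumes X: "right_module A X" and R: "projective_resolution A X R"
    and Z: "ext_vanish A X R u Z"
    and a: "a \<in> mod_hom A Y Z" and b: "b \<in> mod_hom A Z Y" and ba: "\<And>y. y \<in> carrier Y \<Longrightarrow> b (a y) = y"
  shows "ext_vanish A X R u Y"
proof (rule ext_vanishI)
  fix g assume g: "g \<in> mod_hom A (res_syz X R (Suc u)) Y"
  let ?S = "carrier (res_syz X R (Suc u))"
  obtain h where h: "h \<in> mod_hom A (pr_mod R u) Z" "\<And>x. x \<in> ?S \<Longrightarrow> h x = compose ?S a g x"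
    using ext_vanishD[OF Z mod_hom_compose[OF g a res_syz_right_module[OF X R]]] by blast
  have "compose (carrier (pr_mod R u)) b h x = g x" if "x \<in> ?S" for x
    using h(2)[OF that] ba[OF mod_hom_closed[OF g that]] that carrier_res_syz_Suc[OF X R, of x u]
    by (simp add: compose_def del: res_syz.simps)
  then show "\<exists>h \<in> mod_hom A (pr_mod R u) Y. \<forall>x \<in> ?S. h x = g x"
    using mod_hom_compose[OF h(1) b res_right_module[OF X R]] by blast
qed

lemma ext_vanish_injective:
  assumes X: "right_module A X" and R: "projective_resolution A X R" and I: "injective_module A I"
  shows "ext_vanish A X R u I"
proof (rule ext_vanishI)
  let ?S = "res_syz X R (Suc u)"
  fix g assume g: "g \<in> mod_hom A ?S I"
  have i: "(\<lambda>x\<in>carrier ?S. x) \<in> mod_hom A ?S (pr_mod R u)"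
    using mod_hom_incl[OF res_right_module[OF X R] res_kernel_submodule[OF X R]]
    by (simp add: res_syz_Suc[OF X R] del: res_syz.simps(2))
  have "inj_on (\<lambda>x\<in>carrier ?S. x) (carrier ?S)" by (auto simp: inj_on_def simp del: res_syz.simps(2))
  with I[unfolded injective_module_def, THEN conjunct2, rule_format, OF i g]
  show "\<exists>h \<in> mod_hom A (pr_mod R u) I. \<forall>x \<in> carrier ?S. h x = g x"
    using res_syz_right_module[OF X R, of "Suc u"] res_right_module[OF X R] by (auto simp del: res_syz.simps(2))
qed

lemma ext_vanish_shift:
  fixes I W :: "'a univ_module"
  assumes X: "right_module A X" and R: "projective_resolution A X R"
    and j: "j \<in> mod_hom A W' I" "inj_on j (carrier W')"
    and q: "q \<in> mod_hom A I W" "q ` carrier I = carrier W"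
    and ex: "j ` carrier W' = a_kernel I W q"
    and m: "right_module A W'" "right_module A I" "right_module A W"
    and I: "ext_vanish A X R (Suc u) I" and W: "ext_vanish A X R u W"
  shows "ext_vanish A X R (Suc u) W'"
proof (rule ext_vanishI)
  let ?S = "\<lambda>u. res_syz X R u" and ?P = "\<lambda>u. pr_mod R u"
  let ?d = "res_map R (Suc u)"
  note P = res_right_module[OF X R] and S = res_syz_right_module[OF X R]
  note Smem = carrier_res_syz_Suc[OF X R]
  interpret I: right_module A I by fact
  interpret W: right_module A W by fact
  fix g assume g: "g \<in> mod_hom A (?S (Suc (Suc u))) W'"
  obtain h where h: "h \<in> mod_hom A (?P (Suc u)) I" "\<And>x. x \<in> carrier (?S (Suc (Suc u))) \<Longrightarrow> h x = j (g x)"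
    using ext_vanishD[OF I mod_hom_compose[OF g j(1) S]] by (metis compose_eq)
  have jq: "q (j y) = \<zero>\<^bsub>W\<^esub>" if "y \<in> carrier W'" for y
    using ex that by (auto simp: a_kernel_def')
  let ?qh = "compose (carrier (?P (Suc u))) q h"
  have qh: "?qh \<in> mod_hom A (?P (Suc u)) W"
    by (rule mod_hom_compose[OF h(1) q(1) P])
  \<comment> \<open>On the syzygy of index u + 2, \<open>h\<close> agrees with \<open>j\<close>
    after \<open>g\<close>, which \<open>q\<close> annihilates. So \<open>q\<close> after
    \<open>h\<close> descends along the differential to the syzygy of index u + 1.\<close>
  obtain k where k: "k \<in> mod_hom A (?S (Suc u)) W" "\<And>x. x \<in> carrier (?P (Suc u)) \<Longrightarrow> k (?d x) = ?qh x"
  proof (rule mod_hom_factor[OF res_map_hom[OF X R] res_map_surj[OF X R] qh _ P S m(3)])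
    fix x assume x: "x \<in> carrier (?P (Suc u))" "?d x = \<zero>\<^bsub>?S (Suc u)\<^esub>"
    then have "x \<in> carrier (?S (Suc (Suc u)))" using Smem by blast
    then show "?qh x = \<zero>\<^bsub>W\<^esub>"
      using h(2) jq mod_hom_closed[OF g] x by (simp add: compose_def)
  qed blast
  obtain k' where k': "k' \<in> mod_hom A (?P u) W" "\<And>x. x \<in> carrier (?S (Suc u)) \<Longrightarrow> k' x = k x"
    using ext_vanishD[OF W k(1)] by blast
  \<comment> \<open>The extension of \<open>k\<close> exists by vanishing into \<open>W\<close>;
    projectivity of the module in degree u then lifts it through \<open>q\<close>.\<close>
  obtain k'' where k'': "k'' \<in> mod_hom A (?P u) I" "\<And>x. x \<in> carrier (?P u) \<Longrightarrow> q (k'' x) = k' x"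
    using projectiveD[OF res_projective[OF X R] q k'(1) m(2,3)] by blast
  have dP: "?d \<in> mod_hom A (?P (Suc u)) (?P u)" by (rule res_map_hom_pr_mod[OF X R])
  \<comment> \<open>Subtracting \<open>k''\<close> after the differential leaves \<open>h\<close>
    unchanged on the syzygy of index u + 2, where the differential is zero, and pushes its values
    into the kernel of \<open>q\<close>, which is the image of \<open>j\<close>.\<close>
  define H where "H = (\<lambda>x\<in>carrier (?P (Suc u)). h x \<ominus>\<^bsub>I\<^esub> compose (carrier (?P (Suc u))) k'' ?d x)"
  have H: "H \<in> mod_hom A (?P (Suc u)) I"
    unfolding H_def by (intro mod_hom_diff h mod_hom_compose[OF dP] k'' P m)
  have Hx: "H x = h x \<ominus>\<^bsub>I\<^esub> k'' (?d x)" if "x \<in> carrier (?P (Suc u))" for x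
    using that by (simp add: H_def compose_def)
  have "H x \<in> j ` carrier W'" if x: "x \<in> carrier (?P (Suc u))" for x
  proof -
    have "?d x \<in> carrier (?S (Suc u))" by (rule mod_hom_closed[OF res_map_hom[OF X R] x])
    then have "q (k'' (?d x)) = q (h x)"
      using k(2)[OF x] k' k'' mod_hom_closed[OF dP x] x by (simp add: compose_def)
    then have "q (H x) = \<zero>\<^bsub>W\<^esub>"
      using x mod_hom_closed[OF h(1) x] mod_hom_closed[OF k''(1) mod_hom_closed[OF dP x]]
        mod_hom_closed[OF q(1)] W.M.r_neg
      by (simp add: Hx mod_hom_minus[OF q(1) m(2,3)] a_minus_def[of W])
    then show ?thesis using ex mod_hom_closed[OF H x] by (simp add: a_kernel_def')
  qed
  then obtain G where G: "G \<in> mod_hom A (?P (Suc u)) W'" "\<And>x. x \<in> carrier (?P (Suc u)) \<Longrightarrow> j (G x) = H x"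
    using mod_hom_lift_inj[OF j H _ P m(1)] by blast
  have "G x = g x" if x: "x \<in> carrier (?S (Suc (Suc u)))" for x
  proof -
    have xP: "x \<in> carrier (?P (Suc u))" and "?d x = \<zero>\<^bsub>?S (Suc u)\<^esub>" using x Smem by blast+
    then have "?d x = \<zero>\<^bsub>?P u\<^esub>" by simp
    then have "j (G x) = j (g x)"
      using G(2)[OF xP] Hx[OF xP] mod_hom_zero[OF k''(1) P m(2)] h(2)[OF x] mod_hom_closed[OF h(1) xP]
      by (simp add: a_minus_def)
    then show ?thesis
      using inj_onD[OF j(2)] mod_hom_closed[OF G(1) xP] mod_hom_closed[OF g x] by blast
  qed
  then show "\<exists>h\<in>mod_hom A (?P (Suc u)) W'. \<forall>x\<in>carrier (?S (Suc (Suc u))). h x = g x"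
    using G(1) by blast
qed

text \<open>A retract in the stable category modulo projectives, with the retract as the first
  module argument. The weakening is forced: lifts to projective covers are determined only up to
  maps into the kernel, so a strict retraction need not restrict to a strict one on kernels.\<close>

definition stable_retract ::
  "('a, 'r) ring_scheme \<Rightarrow> 'a univ_module \<Rightarrow> 'a univ_module \<Rightarrow> bool"
  where "stable_retract A X' X \<longleftrightarrow> (\<exists>f \<in> mod_hom A X' X. \<exists>g \<in> mod_hom A X X'.
    \<exists>(Q :: 'a univ_module) s t. projective_module A Q \<and> s \<in> mod_hom A X' Q \<and> t \<in> mod_hom A Q X' \<and>
      (\<forall>x \<in> carrier X'. g (f x) = x \<oplus>\<^bsub>X'\<^esub> t (s x)))"

text \<open>Lift both maps along the covers. The error \<open>d\<close> takes values in the kernel,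
  so on kernels the new composite differs from the identity by a map through \<open>P'\<close>:
  inclusion into \<open>P'\<close>, followed by \<open>d\<close>.\<close>

lemma stable_retract_cover:
  fixes X X' P P' :: "'a univ_module"
  assumes sr: "stable_retract A X' X"
    and m: "right_module A X" "right_module A X'"
    and P: "projective_module A P" "p \<in> mod_hom A P X" "p ` carrier P = carrier X"
    and P': "projective_module A P'" "p' \<in> mod_hom A P' X'" "p' ` carrier P' = carrier X'"
  obtains f g d where "f \<in> mod_hom A P' P" "g \<in> mod_hom A P P'" "d \<in> mod_hom A P' P'"
    "\<And>x. x \<in> a_kernel P' X' p' \<Longrightarrow> f x \<in> a_kernel P X p"
    "\<And>x. x \<in> a_kernel P X p \<Longrightarrow> g x \<in> a_kernel P' X' p'"
    "\<And>x. x \<in> carrier P' \<Longrightarrow> d x \<in> a_kernel P' X' p'"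
    "\<And>x. x \<in> a_kernel P' X' p' \<Longrightarrow> g (f x) = x \<oplus>\<^bsub>P'\<^esub> d x"
proof -
  note mP = projective_right_module[OF P(1)] projective_right_module[OF P'(1)]
  interpret X': right_module A X' by fact
  interpret P': right_module A P' by fact
  obtain a b and Q :: "'a univ_module" and s t where ab: "a \<in> mod_hom A X' X" "b \<in> mod_hom A X X'"
    and Q: "projective_module A Q" and st: "s \<in> mod_hom A X' Q" "t \<in> mod_hom A Q X'"
    and eq: "\<And>x. x \<in> carrier X' \<Longrightarrow> b (a x) = x \<oplus>\<^bsub>X'\<^esub> t (s x)"
    using sr unfolding stable_retract_def by blast
  obtain f where f: "f \<in> mod_hom A P' P" "\<And>x. x \<in> carrier P' \<Longrightarrow> p (f x) = compose (carrier P') a p' x"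
    using projectiveD[OF P'(1) P(2,3) mod_hom_compose[OF P'(2) ab(1) mP(2)] mP(1) m(1)] by blast
  obtain g where g: "g \<in> mod_hom A P P'" "\<And>x. x \<in> carrier P \<Longrightarrow> p' (g x) = compose (carrier P) b p x"
    using projectiveD[OF P(1) P'(2,3) mod_hom_compose[OF P(2) ab(2) mP(1)] mP(2) m(2)] by blast
  obtain t' where t': "t' \<in> mod_hom A Q P'" "\<And>x. x \<in> carrier Q \<Longrightarrow> p' (t' x) = t x"
    using projectiveD[OF Q P'(2,3) st(2) mP(2) m(2)] by blast
  \<comment> \<open>\<open>e\<close> is the lifted composite minus the identity, and
    \<open>c\<close> lifts the old error \<open>t\<close> after \<open>s\<close>. Their difference
    \<open>d\<close> is killed by \<open>p'\<close>; on the kernel of \<open>p'\<close> the term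
    \<open>c\<close> vanishes, leaving \<open>d = e\<close> there.\<close>
  define e where "e = (\<lambda>x\<in>carrier P'. compose (carrier P') g f x \<ominus>\<^bsub>P'\<^esub> (\<lambda>x\<in>carrier P'. x) x)"
  define c where "c = compose (carrier P') t' (compose (carrier P') s p')"
  define d where "d = (\<lambda>x\<in>carrier P'. e x \<ominus>\<^bsub>P'\<^esub> c x)"
  have e: "e \<in> mod_hom A P' P'" unfolding e_def
    by (intro mod_hom_diff mod_hom_compose[OF f(1) g(1)] mod_hom_id mP)
  have c: "c \<in> mod_hom A P' P'" unfolding c_def
    by (intro mod_hom_compose[OF mod_hom_compose[OF P'(2) st(1)] t'(1)] mP)
  have d: "d \<in> mod_hom A P' P'" unfolding d_def
    by (intro mod_hom_diff e c mP)
  have dx: "d x = g (f x) \<ominus>\<^bsub>P'\<^esub> x \<ominus>\<^bsub>P'\<^esub> t' (s (p' x))" if "x \<in> carrier P'" for x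
    using that by (simp add: d_def e_def c_def compose_def)
  have p'x: "p' x \<in> carrier X'" if "x \<in> carrier P'" for x by (rule mod_hom_closed[OF P'(2) that])
  have gf: "g (f x) \<in> carrier P'" if "x \<in> carrier P'" for x
    by (rule mod_hom_closed[OF g(1) mod_hom_closed[OF f(1) that]])
  have sx: "s (p' x) \<in> carrier Q" if "x \<in> carrier P'" for x
    by (rule mod_hom_closed[OF st(1) p'x[OF that]])
  have tx: "t' (s (p' x)) \<in> carrier P'" "t (s (p' x)) \<in> carrier X'" if "x \<in> carrier P'" for x
    using mod_hom_closed[OF t'(1)] mod_hom_closed[OF st(2)] sx that by auto
  have zX: "\<zero>\<^bsub>X\<^esub> \<in> carrier X" "\<zero>\<^bsub>X'\<^esub> \<in> carrier X'" "\<zero>\<^bsub>Q\<^esub> \<in> carrier Q"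
    using m projective_right_module[OF Q] abelian_groupE(2)[OF right_module_abelian_group] by auto
  note z = mod_hom_zero[OF ab(1) m(2,1)] mod_hom_zero[OF ab(2) m]
    mod_hom_zero[OF st(1) m(2) projective_right_module[OF Q]] mod_hom_zero[OF t'(1) projective_right_module[OF Q] mP(2)]
  show thesis
  proof (rule that[OF f(1) g(1) d])
    show "f x \<in> a_kernel P X p" if "x \<in> a_kernel P' X' p'" for x
      using that f(2) z mod_hom_closed[OF f(1)] by (auto simp: a_kernel_def' compose_def)
    show "g x \<in> a_kernel P' X' p'" if "x \<in> a_kernel P X p" for x
      using that g(2) z mod_hom_closed[OF g(1)] by (auto simp: a_kernel_def' compose_def)
    show "d x \<in> a_kernel P' X' p'" if x: "x \<in> carrier P'" for x
    proof -
      have "p' (g (f x)) = b (a (p' x))"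
        using x f(2)[OF x] g(2)[OF mod_hom_closed[OF f(1) x]] mod_hom_closed[OF f(1) x]
        by (simp add: compose_def)
      then have "p' (d x) = p' x \<oplus>\<^bsub>X'\<^esub> t (s (p' x)) \<ominus>\<^bsub>X'\<^esub> p' x \<ominus>\<^bsub>X'\<^esub> t (s (p' x))"
        using x gf[OF x] tx[OF x] sx[OF x] p'x[OF x]
        by (simp add: dx mod_hom_minus[OF P'(2) mP(2) m(2)] eq t'(2))
      also have "\<dots> = \<zero>\<^bsub>X'\<^esub>"
        using p'x[OF x] tx[OF x] by (simp add: a_minus_def X'.M.a_ac X'.M.r_neg X'.M.r_neg2)
      finally show ?thesis using mod_hom_closed[OF d x] by (simp add: a_kernel_def')
    qed
    show "g (f x) = x \<oplus>\<^bsub>P'\<^esub> d x" if "x \<in> a_kernel P' X' p'" for x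
    proof -
      have x: "x \<in> carrier P'" "p' x = \<zero>\<^bsub>X'\<^esub>" using that by (auto simp: a_kernel_def')
      have "d x = g (f x) \<ominus>\<^bsub>P'\<^esub> x" using x gf z by (simp add: dx a_minus_def)
      then show ?thesis using x gf[OF x(1)] by (simp add: a_minus_def P'.M.a_ac P'.M.r_neg2 P'.M.r_neg1 P'.M.r_neg)
    qed
  qed
qed

text \<open>At each step the projective module through which the error factors is replaced by the
  term \<open>pr_mod R' u\<close> of the resolution of \<open>X'\<close>. Neither resolution has to
  be minimal.\<close>

lemma stable_retract_syz:
  assumes X: "right_module A X" "projective_resolution A X R"
    and X': "right_module A X'" "projective_resolution A X' R'"
    and sr: "stable_retract A X' X"
  shows "stable_retract A (res_syz X' R' u) (res_syz X R u)"
proof (induction u)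
  case (Suc u)
  let ?P = "pr_mod R u" and ?P' = "pr_mod R' u"
  note mP = res_right_module[OF X, of u] res_right_module[OF X', of u]
  note s = res_kernel_submodule[OF X, of u] res_kernel_submodule[OF X', of u]
  show ?case
  proof (rule stable_retract_cover[OF Suc res_syz_right_module[OF X] res_syz_right_module[OF X']
      res_projective[OF X] res_map_hom[OF X] res_map_surj[OF X]
      res_projective[OF X'] res_map_hom[OF X'] res_map_surj[OF X']])
    fix f g d
    assume fgd: "f \<in> mod_hom A ?P' ?P" "g \<in> mod_hom A ?P ?P'" "d \<in> mod_hom A ?P' ?P'"
    and f: "\<And>x. x \<in> a_kernel ?P' (res_syz X' R' u) (res_map R' u) \<Longrightarrow> f x \<in> a_kernel ?P (res_syz X R u) (res_map R u)"
    and g: "\<And>x. x \<in> a_kernel ?P (res_syz X R u) (res_map R u) \<Longrightarrow> g x \<in> a_kernel ?P' (res_syz X' R' u) (res_map R' u)"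
    and d: "\<And>x. x \<in> carrier ?P' \<Longrightarrow> d x \<in> a_kernel ?P' (res_syz X' R' u) (res_map R' u)"
    and eq: "\<And>x. x \<in> a_kernel ?P' (res_syz X' R' u) (res_map R' u) \<Longrightarrow> g (f x) = x \<oplus>\<^bsub>?P'\<^esub> d x"
    let ?K = "a_kernel ?P (res_syz X R u) (res_map R u)" and ?K' = "a_kernel ?P' (res_syz X' R' u) (res_map R' u)"
    have 1: "restrict f ?K' \<in> mod_hom A (restrict_module ?P' ?K') (restrict_module ?P ?K)"
      using mod_hom_corestrict[OF mod_hom_restrict[OF fgd(1) mP(2) s(2)]] f by simp
    have 2: "restrict g ?K \<in> mod_hom A (restrict_module ?P ?K) (restrict_module ?P' ?K')"
      using mod_hom_corestrict[OF mod_hom_restrict[OF fgd(2) mP(1) s(1)]] g by simp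
    have 3: "d \<in> mod_hom A ?P' (restrict_module ?P' ?K')"
      using mod_hom_corestrict[OF fgd(3) d] .
    have 4: "\<forall>x\<in>carrier (restrict_module ?P' ?K'). restrict g ?K (restrict f ?K' x) =
        x \<oplus>\<^bsub>restrict_module ?P' ?K'\<^esub> d (restrict (\<lambda>x. x) ?K' x)"
      using f eq by simp
    show ?thesis
      unfolding res_syz_Suc[OF X] res_syz_Suc[OF X'] stable_retract_def
      by (rule bexI[OF _ 1], rule bexI[OF _ 2], rule exI[of _ ?P'], rule exI[of _ "restrict (\<lambda>x. x) ?K'"],
        rule exI[of _ d], intro conjI res_projective[OF X', of u] mod_hom_incl[OF mP(2) s(2)] 3 4)
  qed
qed (use sr in simp)

text \<open>Pull \<open>k\<close> back along \<open>g\<close> and extend to \<open>h\<close> on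
  \<open>P\<close>. On the kernel, \<open>h\<close> after \<open>f\<close> equals \<open>k\<close>
  plus \<open>k\<close> after \<open>d\<close>. Since \<open>d\<close> is defined on all of
  \<open>P'\<close> with values in the kernel, this error can be subtracted globally.\<close>

lemma ext_vanish_stable_retract:
  assumes X: "right_module A X" "projective_resolution A X R"
    and X': "right_module A X'" "projective_resolution A X' R'"
    and sr: "stable_retract A X' X" and Y: "right_module A Y"
    and V: "ext_vanish A X R u Y"
  shows "ext_vanish A X' R' u Y"
proof (rule ext_vanishI)
  let ?P = "pr_mod R u" and ?P' = "pr_mod R' u"
  let ?K = "a_kernel ?P (res_syz X R u) (res_map R u)" and ?K' = "a_kernel ?P' (res_syz X' R' u) (res_map R' u)"
  note mP = res_right_module[OF X, of u] res_right_module[OF X', of u]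
  note s = res_kernel_submodule[OF X, of u] res_kernel_submodule[OF X', of u]
  interpret Y: right_module A Y by fact
  fix k assume k: "k \<in> mod_hom A (res_syz X' R' (Suc u)) Y"
  then have k: "k \<in> mod_hom A (restrict_module ?P' ?K') Y" unfolding res_syz_Suc[OF X'] .
  obtain f g d where fgd: "f \<in> mod_hom A ?P' ?P" "g \<in> mod_hom A ?P ?P'" "d \<in> mod_hom A ?P' ?P'"
    and f: "\<And>x. x \<in> ?K' \<Longrightarrow> f x \<in> ?K"
    and g: "\<And>x. x \<in> ?K \<Longrightarrow> g x \<in> ?K'"
    and d: "\<And>x. x \<in> carrier ?P' \<Longrightarrow> d x \<in> ?K'"
    and eq: "\<And>x. x \<in> ?K' \<Longrightarrow> g (f x) = x \<oplus>\<^bsub>?P'\<^esub> d x"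
    using stable_retract_cover[OF stable_retract_syz[OF X X' sr] res_syz_right_module[OF X] res_syz_right_module[OF X']
      res_projective[OF X] res_map_hom[OF X] res_map_surj[OF X]
      res_projective[OF X'] res_map_hom[OF X'] res_map_surj[OF X']] by blast
  have 2: "restrict g ?K \<in> mod_hom A (restrict_module ?P ?K) (restrict_module ?P' ?K')"
    using mod_hom_corestrict[OF mod_hom_restrict[OF fgd(2) mP(1) s(1)]] g by simp
  have 3: "d \<in> mod_hom A ?P' (restrict_module ?P' ?K')"
    using mod_hom_corestrict[OF fgd(3) d] .
  obtain h where h: "h \<in> mod_hom A ?P Y" "\<And>x. x \<in> ?K \<Longrightarrow> h x = k (g x)"
  proof -
    have "compose ?K k (restrict g ?K) \<in> mod_hom A (res_syz X R (Suc u)) Y"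
      using mod_hom_compose[OF 2 k right_module_restrict[OF s(1) mP(1)]]
      unfolding res_syz_Suc[OF X] by simp
    from ext_vanishD[OF V this] show ?thesis using that unfolding res_syz_Suc[OF X]
      by (auto simp: compose_def)
  qed
  let ?h = "\<lambda>x\<in>carrier ?P'. compose (carrier ?P') h f x \<ominus>\<^bsub>Y\<^esub> compose (carrier ?P') k d x"
  have "?h \<in> mod_hom A ?P' Y"
    by (intro mod_hom_diff mod_hom_compose[OF fgd(1) h(1)] mod_hom_compose[OF 3 k] mP Y)
  moreover have "?h x = k x" if x: "x \<in> ?K'" for x
  proof -
    have xP: "x \<in> carrier ?P'" using x by (simp add: a_kernel_def')
    have "h (f x) = k x \<oplus>\<^bsub>Y\<^esub> k (d x)"
      using h(2)[OF f[OF x]] eq[OF x] mod_hom_add[OF k, of x "d x"] x d[OF xP] by simp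
    then show ?thesis using xP mod_hom_closed[OF k, of x] mod_hom_closed[OF k, of "d x"] x d[OF xP]
      by (simp add: compose_def a_minus_def Y.M.a_ac Y.M.r_neg)
  qed
  ultimately show "\<exists>h\<in>mod_hom A ?P' Y. \<forall>x\<in>carrier (res_syz X' R' (Suc u)). h x = k x"
    unfolding res_syz_Suc[OF X'] by (intro bexI[of _ ?h]) auto
qed

section \<open>Free modules, finite generation and noetherianity\<close>

fun res_drop :: "('a, 'a list) proj_res \<Rightarrow> nat \<Rightarrow> ('a, 'a list) proj_res"
  where
    "res_drop R 0 = R"
  | "res_drop R (Suc j) =
      \<lparr>pr_mod = (\<lambda>i. pr_mod R (Suc j + i)), pr_diff = (\<lambda>i. pr_diff R (Suc j + i)), pr_aug = pr_diff R j\<rparr>"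

lemma pr_kernel_drop:
  "pr_kernel (res_syz X R u) (res_drop R u) i = pr_kernel X R (u + i)"
  by (cases u; cases i) (simp_all add: a_kernel_def')

lemma pr_mod_drop: "pr_mod (res_drop R u) i = pr_mod R (u + i)"
  by (cases u) simp_all

lemma res_syz_drop: "res_syz (res_syz X R u) (res_drop R u) v = res_syz X R (u + v)"
  using pr_kernel_drop[of X R u] by (cases v) (simp_all add: pr_mod_drop)

text \<open>Dimension shift in the first variable is a plain equality here, because the syzygies of
  the tail are literally those of the original resolution.\<close>

lemma ext_vanish_drop:
  "ext_vanish A (res_syz X R u) (res_drop R u) v Y \<longleftrightarrow> ext_vanish A X R (u + v) Y"
  unfolding ext_vanish_def res_syz_drop pr_mod_drop by simp

lemma projective_resolution_drop:
  assumes "projective_resolution A X R"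
  shows "projective_resolution A (res_syz X R u) (res_drop R u)"
proof (cases u)
  case (Suc j)
  have "pr_diff R j \<in> mod_hom A (pr_mod R (Suc j)) (pr_syzygy X R j)"
  proof (rule mod_hom_corestrict)
    have "pr_diff R j ` carrier (pr_mod R (Suc j)) = pr_kernel X R j"
      using assms by (simp add: projective_resolution_def)
    then show "pr_diff R j x \<in> pr_kernel X R j" if "x \<in> carrier (pr_mod R (Suc j))" for x
      using that by blast
  qed (use assms in \<open>simp add: projective_resolution_def\<close>)
  then show ?thesis
    using assms pr_kernel_drop[of X R u] unfolding Suc projective_resolution_def by simp
qed (use assms in simp)

section \<open>Finitely generated modules and finite free modules\<close>

fun lincomb :: "('a, 'm) module \<Rightarrow> 'a list \<Rightarrow> 'm list \<Rightarrow> 'm"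
  where
    "lincomb M (a # as) (x # xs) = a \<odot>\<^bsub>M\<^esub> x \<oplus>\<^bsub>M\<^esub> lincomb M as xs"
  | "lincomb M _ _ = \<zero>\<^bsub>M\<^esub>"

text \<open>Coefficient tuples are encoded as lists of fixed length, which places the module in the
  type \<open>'a univ_module\<close> over which projectivity quantifies. The components
  \<open>mult\<close> and \<open>one\<close> are fillers.\<close>

definition free_module :: "('a, 'r) ring_scheme \<Rightarrow> nat \<Rightarrow> 'a univ_module"
  where "free_module A k =
    \<lparr>carrier = {as. length as = k \<and> set as \<subseteq> carrier A}, mult = (\<lambda>x y. x), one = [],
     zero = replicate k \<zero>\<^bsub>A\<^esub>, add = map2 (add A), smult = (\<lambda>a. map (\<lambda>x. x \<otimes>\<^bsub>A\<^esub> a))\<rparr>"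

lemma free_module_simps:
  "carrier (free_module A k) = {as. length as = k \<and> set as \<subseteq> carrier A}"
  "\<zero>\<^bsub>free_module A k\<^esub> = replicate k \<zero>\<^bsub>A\<^esub>"
  "as \<oplus>\<^bsub>free_module A k\<^esub> bs = map2 (add A) as bs"
  "a \<odot>\<^bsub>free_module A k\<^esub> as = map (\<lambda>x. x \<otimes>\<^bsub>A\<^esub> a) as"
  by (simp_all add: free_module_def)

lemma free_module_carrier_iff:
  "as \<in> carrier (free_module A k) \<longleftrightarrow> length as = k \<and> (\<forall>i<k. as ! i \<in> carrier A)"
  by (auto simp: free_module_simps set_conv_nth)

lemma right_module_free:
  assumes "ring A"
  shows "right_module A (free_module A k)"
proof -
  interpret A: ring A by fact
  show ?thesis
  proof (intro right_module.intro right_module_axioms.intro)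
    show "abelian_group (free_module A k)"
    proof (rule abelian_groupI)
      show "\<exists>y\<in>carrier (free_module A k). y \<oplus>\<^bsub>free_module A k\<^esub> x = \<zero>\<^bsub>free_module A k\<^esub>"
        if "x \<in> carrier (free_module A k)" for x
        using that unfolding free_module_carrier_iff
        by (intro bexI[of _ "map (a_inv A) x"])
          (auto simp: free_module_carrier_iff free_module_simps(2-) A.l_neg intro!: nth_equalityI)
    qed (auto simp: free_module_carrier_iff free_module_simps(2-) A.a_ac intro!: nth_equalityI)
  qed (auto simp: free_module_carrier_iff free_module_simps(2-) A.l_distr A.r_distr A.m_assoc
      A.ring_axioms in_set_conv_nth intro!: nth_equalityI)
qed

lemma right_module_regular:
  assumes "ring A"
  shows "right_module A (regular_module A)"
proof -
  interpret A: ring A by fact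
  show ?thesis
  proof (intro right_module.intro right_module_axioms.intro)
    show "abelian_group (regular_module A)"
      by (rule abelian_groupI)
        (auto simp: regular_module_def A.a_ac A.l_neg intro: bexI[of _ "a_inv A _"])
  qed (auto simp: regular_module_def A.l_distr A.r_distr A.m_assoc A.ring_axioms)
qed

lemma smult_zero_left:
  assumes "right_module A M" "x \<in> carrier M"
  shows "\<zero>\<^bsub>A\<^esub> \<odot>\<^bsub>M\<^esub> x = \<zero>\<^bsub>M\<^esub>"
proof -
  interpret M: right_module A M by fact
  have "\<zero>\<^bsub>A\<^esub> \<odot>\<^bsub>M\<^esub> x \<oplus>\<^bsub>M\<^esub> \<zero>\<^bsub>A\<^esub> \<odot>\<^bsub>M\<^esub> x = \<zero>\<^bsub>A\<^esub> \<odot>\<^bsub>M\<^esub> x"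
    using assms(2) M.act_add_scalar[of "\<zero>\<^bsub>A\<^esub>" "\<zero>\<^bsub>A\<^esub>" x] by simp
  then show ?thesis using assms(2) M.act_closed[of "\<zero>\<^bsub>A\<^esub>" x] by simp
qed

lemma lincomb_closed:
  assumes "right_module A M" "length as = length xs" "set as \<subseteq> carrier A" "set xs \<subseteq> carrier M"
  shows "lincomb M as xs \<in> carrier M"
proof -
  interpret M: right_module A M by fact
  show ?thesis using assms(2-) by (induction rule: list_induct2) (auto simp: M.act_closed)
qed

lemma lincomb_hom:
  assumes M: "right_module A M" and xs: "set xs \<subseteq> carrier M"
  shows "(\<lambda>as\<in>carrier (free_module A (length xs)). lincomb M as xs) \<in> mod_hom A (free_module A (length xs)) M"
proof -
  interpret M: right_module A M by fact
  have c: "lincomb M as xs \<in> carrier M" if "length as = length xs" "set as \<subseteq> carrier A" for as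
    using lincomb_closed[OF M that xs] .
  have a: "lincomb M (map2 (add A) as bs) xs = lincomb M as xs \<oplus>\<^bsub>M\<^esub> lincomb M bs xs"
    if "length as = length bs" "length bs = length xs" "set as \<subseteq> carrier A" "set bs \<subseteq> carrier A" for as bs
    using that xs
  proof (induction rule: list_induct3)
    case (Cons a as b bs x xs)
    then have "lincomb M as xs \<in> carrier M" "lincomb M bs xs \<in> carrier M"
      by (auto intro!: lincomb_closed[OF M])
    then show ?case using Cons by (simp add: M.act_add_scalar M.act_closed M.M.a_ac)
  qed simp
  have s: "lincomb M (map (\<lambda>x. x \<otimes>\<^bsub>A\<^esub> a) as) xs = a \<odot>\<^bsub>M\<^esub> lincomb M as xs"
    if "length as = length xs" "set as \<subseteq> carrier A" "a \<in> carrier A" for as a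
    using that xs
  proof (induction rule: list_induct2)
    case Nil then show ?case by (simp add: smult_zero_right[OF M])
  next
    case (Cons b as x xs)
    then show ?case by (simp add: M.act_mult M.act_add M.act_closed lincomb_closed[OF M])
  qed
  show ?thesis
    by (rule mod_hom_restrictI[OF right_module_free[OF M.R.ring_axioms]])
      (auto simp: free_module_simps c a s)
qed

definition span_list :: "('a, 'r) ring_scheme \<Rightarrow> ('a, 'm) module \<Rightarrow> 'm list \<Rightarrow> 'm set"
  where "span_list A M xs = (\<lambda>as. lincomb M as xs) ` carrier (free_module A (length xs))"

lemma set_subset_span_list:
  assumes M: "right_module A M" and xs: "set xs \<subseteq> carrier M"
  shows "set xs \<subseteq> span_list A M xs"
  using xs
proof (induction xs)
  case (Cons x xs)
  interpret M: right_module A M by fact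
  have z: "lincomb M (replicate (length xs) \<zero>\<^bsub>A\<^esub>) xs = \<zero>\<^bsub>M\<^esub>" if "set xs \<subseteq> carrier M" for xs
    using that by (induction xs) (auto simp: smult_zero_left[OF M])
  have "x \<in> span_list A M (x # xs)"
    unfolding span_list_def using Cons.prems
    by (intro image_eqI[of _ _ "\<one>\<^bsub>A\<^esub> # replicate (length xs) \<zero>\<^bsub>A\<^esub>"])
      (auto simp: z M.act_one free_module_simps)
  moreover have "span_list A M xs \<subseteq> span_list A M (x # xs)"
  proof
    fix y assume "y \<in> span_list A M xs"
    then obtain as where as: "as \<in> carrier (free_module A (length xs))" "y = lincomb M as xs"
      by (auto simp: span_list_def)
    moreover have "y \<in> carrier M"
      using mod_hom_closed[OF lincomb_hom[OF M] as(1)] Cons.prems as by simp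
    ultimately show "y \<in> span_list A M (x # xs)"
      unfolding span_list_def using Cons.prems
      by (intro image_eqI[of _ _ "\<zero>\<^bsub>A\<^esub> # as"]) (auto simp: smult_zero_left[OF M] free_module_simps)
  qed
  ultimately show ?case using Cons by auto
qed simp

lemma submodule_image:
  assumes f: "f \<in> mod_hom A M N" and m: "right_module A M" "right_module A N"
  shows "submodule (f ` carrier M) A N"
proof -
  interpret M: right_module A M by fact
  have "f x \<oplus>\<^bsub>N\<^esub> f y \<in> f ` carrier M" if "x \<in> carrier M" "y \<in> carrier M" for x y
    using that by (intro image_eqI[of _ _ "x \<oplus>\<^bsub>M\<^esub> y"]) (simp_all add: mod_hom_add[OF f])
  moreover have "a \<odot>\<^bsub>N\<^esub> f x \<in> f ` carrier M" if "x \<in> carrier M" "a \<in> carrier A" for x a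
    using that by (intro image_eqI[of _ _ "a \<odot>\<^bsub>M\<^esub> x"]) (simp_all add: mod_hom_smult[OF f] M.act_closed)
  moreover have "\<zero>\<^bsub>N\<^esub> \<in> f ` carrier M"
    by (intro image_eqI[of _ _ "\<zero>\<^bsub>M\<^esub>"]) (simp_all add: mod_hom_zero[OF f m])
  ultimately show ?thesis
    unfolding submodule_iff[OF m(2)] using mod_hom_closed[OF f] by auto
qed

lemma submodule_preimage:
  assumes f: "f \<in> mod_hom A M N" and m: "right_module A M" "right_module A N" and U: "submodule U A N"
  shows "submodule {x \<in> carrier M. f x \<in> U} A M"
proof -
  interpret M: right_module A M by fact
  show ?thesis
    using U unfolding submodule_iff[OF m(1)] submodule_iff[OF m(2)]
    by (auto simp: mod_hom_zero[OF f m] mod_hom_add[OF f] mod_hom_smult[OF f] M.act_closed)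
qed

lemma fg_moduleE:
  assumes "fg_module A M"
  obtains S where "right_module A M" "finite S" "S \<subseteq> carrier M"
    "\<And>U. submodule U A M \<Longrightarrow> S \<subseteq> U \<Longrightarrow> U = carrier M"
  using assms[unfolded fg_module_def] by (elim conjE exE) (rule, auto)

lemma fg_free_cover:
  assumes "fg_module A M"
  obtains k p where "p \<in> mod_hom A (free_module A k) M" "p ` carrier (free_module A k) = carrier M"
proof -
  obtain S where M: "right_module A M" and S: "finite S" "S \<subseteq> carrier M"
    "\<And>U. submodule U A M \<Longrightarrow> S \<subseteq> U \<Longrightarrow> U = carrier M"
    by (rule fg_moduleE[OF assms]) blast
  obtain xs where xs: "set xs = S" using finite_list[OF S(1)] by blast
  let ?p = "\<lambda>as\<in>carrier (free_module A (length xs)). lincomb M as xs"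
  have p: "?p \<in> mod_hom A (free_module A (length xs)) M"
    using lincomb_hom[OF M] xs S(2) by auto
  have "S \<subseteq> ?p ` carrier (free_module A (length xs))"
    using set_subset_span_list[OF M] xs S(2) by (auto simp: span_list_def)
  then have "?p ` carrier (free_module A (length xs)) = carrier M"
    using S(3) submodule_image[OF p right_module_free[OF right_module_ring[OF M]] M] by blast
  then show thesis using that p by blast
qed

lemma fg_module_image:
  assumes M: "fg_module A M" and f: "f \<in> mod_hom A M N" "f ` carrier M = carrier N" and N: "right_module A N"
  shows "fg_module A N"
proof -
  obtain S where m: "right_module A M" and S: "finite S" "S \<subseteq> carrier M"
    "\<And>U. submodule U A M \<Longrightarrow> S \<subseteq> U \<Longrightarrow> U = carrier M"
    by (rule fg_moduleE[OF M]) blast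
  have "U = carrier N" if U: "submodule U A N" "f ` S \<subseteq> U" for U
  proof -
    have "{x \<in> carrier M. f x \<in> U} = carrier M"
      using U S(2) by (intro S(3) submodule_preimage[OF f(1) m N]) auto
    then have "f ` carrier M \<subseteq> U" by blast
    then show ?thesis using f(2) submodule_subset[OF U(1) N] by blast
  qed
  moreover have "f ` S \<subseteq> carrier N" using S(2) f(2) by blast
  ultimately show ?thesis unfolding fg_module_def using N S(1)
    by (intro conjI exI[of _ "f ` S"]) auto
qed

text \<open>A finitely generated module is a quotient of a finite free module, whose elements are
  already lists. One chosen representative per element gives a carrier inside
  \<open>'a list\<close>, to which the structure is transported.\<close>

lemma univ_copy:
  assumes "fg_module A M"
  obtains N :: "'a univ_module" and f g where "fg_module A N" "f \<in> mod_hom A M N" "g \<in> mod_hom A N M"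
    "\<And>x. x \<in> carrier M \<Longrightarrow> g (f x) = x" "\<And>y. y \<in> carrier N \<Longrightarrow> f (g y) = y"
proof -
  obtain k p where p: "p \<in> mod_hom A (free_module A k) M" "p ` carrier (free_module A k) = carrier M"
    using fg_free_cover[OF assms] .
  have M: "right_module A M" using fg_right_module[OF assms] .
  interpret M: right_module A M by fact
  define e where "e = inv_into (carrier (free_module A k)) p"
  have pe: "p (e x) = x" if "x \<in> carrier M" for x
    using that p(2) by (auto simp: e_def f_inv_into_f)
  define N :: "'a univ_module" where "N = \<lparr>carrier = e ` carrier M, mult = (\<lambda>x y. x), one = [], zero = e \<zero>\<^bsub>M\<^esub>,
    add = (\<lambda>x y. e (p x \<oplus>\<^bsub>M\<^esub> p y)), smult = (\<lambda>a x. e (a \<odot>\<^bsub>M\<^esub> p x))\<rparr>"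
  have N: "right_module A N"
  proof (intro right_module.intro right_module_axioms.intro)
    show "abelian_group N"
      by (rule abelian_groupI) (auto simp: N_def pe M.M.a_ac M.M.r_neg intro!: bexI[of _ "\<ominus>\<^bsub>M\<^esub> _"])
  qed (auto simp: N_def pe M.act_closed M.act_add M.act_add_scalar M.act_mult M.act_one M.R.ring_axioms)
  have f: "restrict e (carrier M) \<in> mod_hom A M N"
    by (rule mod_hom_restrictI[OF M]) (auto simp: N_def pe M.act_closed)
  have g: "restrict p (carrier N) \<in> mod_hom A N M"
    by (rule mod_hom_restrictI[OF N]) (auto simp: N_def pe M.act_closed)
  show thesis
  proof (rule that[OF fg_module_image[OF assms f _ N] f g])
  qed (auto simp: N_def pe)
qed

section \<open>Submodules of finitely generated modules over a noetherian ring\<close>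

lemma right_noetherian_finite:
  assumes "ring A" "right_noetherian A" "submodule I A (regular_module A)"
  obtains S where "finite S" "S \<subseteq> I" "\<And>J. submodule J A (regular_module A) \<Longrightarrow> S \<subseteq> J \<Longrightarrow> I \<subseteq> J"
proof -
  note m = right_module_regular[OF assms(1)]
  obtain S where S: "finite S" "S \<subseteq> I"
    "\<And>U. submodule U A (restrict_module (regular_module A) I) \<Longrightarrow> S \<subseteq> U \<Longrightarrow> U = I"
    using assms(2,3) by (auto simp: right_noetherian_def fg_module_def)
  have "I \<subseteq> J" if "submodule J A (regular_module A)" "S \<subseteq> J" for J
  proof -
    have "I \<inter> J = I"
      using that S(2) by (intro S(3)) (auto simp: submodule_restrict_iff[OF assms(3) m] submodule_Int[OF assms(3) _ m])
    then show ?thesis by blast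
  qed
  then show thesis using that S by blast
qed

text \<open>Finite generation below \<open>V\<close> is phrased through submodules of the fixed
  ambient module, so that the induction on generators never meets nested restricted modules.\<close>

definition noetherian_submodule :: "('a, 'r) ring_scheme \<Rightarrow> ('a, 'm) module \<Rightarrow> 'm set \<Rightarrow> bool"
  where "noetherian_submodule A M V \<longleftrightarrow> submodule V A M \<and>
    (\<forall>U. submodule U A M \<and> U \<subseteq> V \<longrightarrow>
      (\<exists>S. finite S \<and> S \<subseteq> U \<and> (\<forall>T. submodule T A M \<and> S \<subseteq> T \<longrightarrow> U \<subseteq> T)))"

text \<open>Classical argument for a single additional generator x: a submodule of V + x A is
  controlled by its intersection with V and by the right ideal of coefficients of x that occur in
  it.\<close>

lemma noetherian_submodule_extend:
  assumes A: "right_noetherian A" and M: "right_module A M"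
    and V: "noetherian_submodule A M V" and x: "x \<in> carrier M"
  shows "noetherian_submodule A M {w \<oplus>\<^bsub>M\<^esub> a \<odot>\<^bsub>M\<^esub> x |w a. w \<in> V \<and> a \<in> carrier A}" (is "noetherian_submodule A M ?V'")
proof -
  interpret M: right_module A M by fact
  have sV: "submodule V A M" using V by (simp add: noetherian_submodule_def)
  note Vc = submodule_carrier[OF sV M]
  note V0 = submodule_zero[OF sV M] and Vadd = submodule_add[OF sV M] and Vsm = submodule_smult[OF sV M]
  have add: "(w \<oplus>\<^bsub>M\<^esub> a \<odot>\<^bsub>M\<^esub> x) \<oplus>\<^bsub>M\<^esub> (w' \<oplus>\<^bsub>M\<^esub> a' \<odot>\<^bsub>M\<^esub> x) = (w \<oplus>\<^bsub>M\<^esub> w') \<oplus>\<^bsub>M\<^esub> (a \<oplus>\<^bsub>A\<^esub> a') \<odot>\<^bsub>M\<^esub> x"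
    if "w \<in> V" "w' \<in> V" "a \<in> carrier A" "a' \<in> carrier A" for w w' a a'
    using that x Vc by (simp add: M.act_add_scalar M.act_closed M.M.a_ac)
  have sm: "b \<odot>\<^bsub>M\<^esub> (w \<oplus>\<^bsub>M\<^esub> a \<odot>\<^bsub>M\<^esub> x) = b \<odot>\<^bsub>M\<^esub> w \<oplus>\<^bsub>M\<^esub> (a \<otimes>\<^bsub>A\<^esub> b) \<odot>\<^bsub>M\<^esub> x"
    if "w \<in> V" "a \<in> carrier A" "b \<in> carrier A" for w a b
    using that x Vc by (simp add: M.act_add M.act_mult M.act_closed)
  have "submodule ?V' A M"
    unfolding submodule_iff[OF M]
  proof (intro conjI ballI)
    show "?V' \<subseteq> carrier M" using x Vc by (auto simp: M.act_closed)
    show "\<zero>\<^bsub>M\<^esub> \<in> ?V'" using V0 x by (auto simp: smult_zero_left[OF M x] intro!: exI[of _ "\<zero>\<^bsub>M\<^esub>"] exI[of _ "\<zero>\<^bsub>A\<^esub>"])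
    show "y \<oplus>\<^bsub>M\<^esub> z \<in> ?V'" if "y \<in> ?V'" "z \<in> ?V'" for y z
    proof -
      from that obtain w a w' a' where "w \<in> V" "w' \<in> V" "a \<in> carrier A" "a' \<in> carrier A"
        "y = w \<oplus>\<^bsub>M\<^esub> a \<odot>\<^bsub>M\<^esub> x" "z = w' \<oplus>\<^bsub>M\<^esub> a' \<odot>\<^bsub>M\<^esub> x" by blast
      then show ?thesis using add Vadd by blast
    qed
    show "b \<odot>\<^bsub>M\<^esub> y \<in> ?V'" if "b \<in> carrier A" "y \<in> ?V'" for b y
    proof -
      from that obtain w a where "w \<in> V" "a \<in> carrier A" "y = w \<oplus>\<^bsub>M\<^esub> a \<odot>\<^bsub>M\<^esub> x" by blast
      then show ?thesis using sm Vsm that(1) by blast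
    qed
  qed
  moreover have "\<exists>S. finite S \<and> S \<subseteq> U \<and> (\<forall>T. submodule T A M \<and> S \<subseteq> T \<longrightarrow> U \<subseteq> T)"
    if U: "submodule U A M" "U \<subseteq> ?V'" for U
  proof -
    \<comment> \<open>The ideal of leading coefficients: those a for which x a lies in T modulo
      V.\<close>
    define J where "J T = {a \<in> carrier A. \<exists>w\<in>V. w \<oplus>\<^bsub>M\<^esub> a \<odot>\<^bsub>M\<^esub> x \<in> T}" for T
    have J: "submodule (J T) A (regular_module A)" if T: "submodule T A M" for T
      unfolding submodule_iff[OF right_module_regular[OF M.R.ring_axioms]]
    proof (intro conjI ballI)
      show "J T \<subseteq> carrier (regular_module A)" by (auto simp: J_def regular_module_def)
      show "\<zero>\<^bsub>regular_module A\<^esub> \<in> J T"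
        using V0 submodule_zero[OF T M] by (auto simp: J_def regular_module_def smult_zero_left[OF M x] intro!: bexI[of _ "\<zero>\<^bsub>M\<^esub>"])
      show "a \<oplus>\<^bsub>regular_module A\<^esub> b \<in> J T" if ab: "a \<in> J T" "b \<in> J T" for a b
      proof -
        from ab obtain w w' where "a \<in> carrier A" "b \<in> carrier A" "w \<in> V" "w' \<in> V"
          "w \<oplus>\<^bsub>M\<^esub> a \<odot>\<^bsub>M\<^esub> x \<in> T" "w' \<oplus>\<^bsub>M\<^esub> b \<odot>\<^bsub>M\<^esub> x \<in> T" by (auto simp: J_def)
        then show ?thesis using add[of w w' a b] submodule_add[OF T M, of "w \<oplus>\<^bsub>M\<^esub> a \<odot>\<^bsub>M\<^esub> x" "w' \<oplus>\<^bsub>M\<^esub> b \<odot>\<^bsub>M\<^esub> x"] Vadd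
          by (auto simp: J_def regular_module_def intro!: bexI[of _ "w \<oplus>\<^bsub>M\<^esub> w'"])
      qed
      show "b \<odot>\<^bsub>regular_module A\<^esub> a \<in> J T" if ab: "a \<in> J T" "b \<in> carrier A" for a b
      proof -
        from ab obtain w where "a \<in> carrier A" "w \<in> V" "w \<oplus>\<^bsub>M\<^esub> a \<odot>\<^bsub>M\<^esub> x \<in> T" by (auto simp: J_def)
        then show ?thesis using sm[of w a b] submodule_smult[OF T M ab(2), of "w \<oplus>\<^bsub>M\<^esub> a \<odot>\<^bsub>M\<^esub> x"] Vsm ab(2)
          by (auto simp: J_def regular_module_def intro!: bexI[of _ "b \<odot>\<^bsub>M\<^esub> w"])
      qed
    qed
    obtain B where B: "finite B" "B \<subseteq> J U" "\<And>K. submodule K A (regular_module A) \<Longrightarrow> B \<subseteq> K \<Longrightarrow> J U \<subseteq> K"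
      using right_noetherian_finite[OF M.R.ring_axioms A J[OF U(1)]] by blast
    have "\<forall>b\<in>B. \<exists>w. w \<in> V \<and> w \<oplus>\<^bsub>M\<^esub> b \<odot>\<^bsub>M\<^esub> x \<in> U" using B(2) by (auto simp: J_def)
    then obtain w where w: "\<forall>b\<in>B. w b \<in> V \<and> w b \<oplus>\<^bsub>M\<^esub> b \<odot>\<^bsub>M\<^esub> x \<in> U" by metis
    have "submodule (U \<inter> V) A M" by (rule submodule_Int[OF U(1) sV M])
    then obtain S where S: "finite S" "S \<subseteq> U \<inter> V" "\<And>T. submodule T A M \<Longrightarrow> S \<subseteq> T \<Longrightarrow> U \<inter> V \<subseteq> T"
      using V unfolding noetherian_submodule_def by (metis inf_le2)
    let ?S = "S \<union> (\<lambda>b. w b \<oplus>\<^bsub>M\<^esub> b \<odot>\<^bsub>M\<^esub> x) ` B"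
    have "U \<subseteq> T" if T: "submodule T A M" "?S \<subseteq> T" for T
    proof
      fix z assume z: "z \<in> U"
      have UT: "submodule (U \<inter> T) A M" by (rule submodule_Int[OF U(1) T(1) M])
      obtain v a where va: "v \<in> V" "a \<in> carrier A" "z = v \<oplus>\<^bsub>M\<^esub> a \<odot>\<^bsub>M\<^esub> x" using U(2) z by blast
      have "w b \<oplus>\<^bsub>M\<^esub> b \<odot>\<^bsub>M\<^esub> x \<in> U \<inter> T" if "b \<in> B" for b
        using w T(2) that by blast
      then have "B \<subseteq> J (U \<inter> T)" using w B(2) unfolding J_def by blast
      then have "J U \<subseteq> J (U \<inter> T)" by (intro B(3) J[OF UT])
      moreover have "a \<in> J U" using va z by (auto simp: J_def)
      ultimately obtain v' where v': "v' \<in> V" "v' \<oplus>\<^bsub>M\<^esub> a \<odot>\<^bsub>M\<^esub> x \<in> U \<inter> T" by (auto simp: J_def)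
      let ?z' = "v' \<oplus>\<^bsub>M\<^esub> a \<odot>\<^bsub>M\<^esub> x"
      \<comment> \<open>Both elements have the same coefficient \<open>a\<close> at
        \<open>x\<close>, so these terms cancel and the difference falls into \<open>U\<close> and
        \<open>V\<close>, where the generators \<open>S\<close> take over.\<close>
      have "z \<ominus>\<^bsub>M\<^esub> ?z' = v \<ominus>\<^bsub>M\<^esub> v'"
        using va v' x Vc by (simp add: a_minus_def M.M.minus_add M.act_closed M.M.a_ac M.M.r_neg M.M.r_neg1)
      then have "z \<ominus>\<^bsub>M\<^esub> ?z' \<in> U \<inter> V"
        using submodule_minus[OF U(1) M z, of ?z'] submodule_minus[OF sV M va(1) v'(1)] v'(2) by simp
      then have "z \<ominus>\<^bsub>M\<^esub> ?z' \<in> T" using S(3)[OF T(1)] T(2) by blast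
      then have "(z \<ominus>\<^bsub>M\<^esub> ?z') \<oplus>\<^bsub>M\<^esub> ?z' \<in> T"
        using submodule_add[OF T(1) M] v'(2) by blast
      moreover have "(z \<ominus>\<^bsub>M\<^esub> ?z') \<oplus>\<^bsub>M\<^esub> ?z' = z"
        using submodule_carrier[OF U(1) M z] submodule_carrier[OF U(1) M, of ?z'] v'(2)
        by (simp add: a_minus_def M.M.a_assoc M.M.l_neg)
      ultimately show "z \<in> T" by simp
    qed
    then show ?thesis using S(1,2) B(1) w by (intro exI[of _ ?S]) auto
  qed
  ultimately show ?thesis unfolding noetherian_submodule_def by blast
qed

text \<open>Induction on a finite generating set, starting at the zero submodule and adjoining one
  generator at a time.\<close>

lemma noetherian_submodule_carrier:
  assumes A: "right_noetherian A" and fg: "fg_module A M"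
  shows "noetherian_submodule A M (carrier M)"
proof -
  have M: "right_module A M" using fg_right_module[OF fg] .
  interpret M: right_module A M by fact
  obtain S where S: "finite S" "S \<subseteq> carrier M" "\<And>U. submodule U A M \<Longrightarrow> S \<subseteq> U \<Longrightarrow> U = carrier M"
    by (rule fg_moduleE[OF fg]) blast
  from S(1,2) have "\<exists>V. noetherian_submodule A M V \<and> S \<subseteq> V"
  proof (induction rule: finite_induct)
    case empty
    have "noetherian_submodule A M {\<zero>\<^bsub>M\<^esub>}"
      unfolding noetherian_submodule_def
      using submodule_zero_self[OF M] submodule_zero[OF _ M] by (auto intro!: exI[of _ "{}"])
    then show ?case by blast
  next
    case (insert x S)
    then obtain V where V: "noetherian_submodule A M V" "S \<subseteq> V" by auto
    have x: "x \<in> carrier M" using insert by simp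
    let ?V = "{w \<oplus>\<^bsub>M\<^esub> a \<odot>\<^bsub>M\<^esub> x |w a. w \<in> V \<and> a \<in> carrier A}"
    have sV: "submodule V A M" using V by (simp add: noetherian_submodule_def)
    have "v \<in> ?V" if "v \<in> V" for v
      using that submodule_carrier[OF sV M that] smult_zero_left[OF M x]
      by (auto intro!: exI[of _ v] exI[of _ "\<zero>\<^bsub>A\<^esub>"])
    moreover have "x \<in> ?V"
      using submodule_zero[OF sV M] x M.act_one[OF x]
      by (auto intro!: exI[of _ "\<zero>\<^bsub>M\<^esub>"] exI[of _ "\<one>\<^bsub>A\<^esub>"])
    ultimately show ?case using noetherian_submodule_extend[OF A M V(1) x] V(2) by blast
  qed
  then obtain V where "noetherian_submodule A M V" "S \<subseteq> V" by blast
  then show ?thesis using S(3)[of V] by (simp add: noetherian_submodule_def)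
qed

lemma fg_submodule:
  assumes A: "right_noetherian A" and fg: "fg_module A M" and U: "submodule U A M"
  shows "fg_module A (restrict_module M U)"
proof -
  have M: "right_module A M" using fg_right_module[OF fg] .
  obtain S where "finite S" "S \<subseteq> U" "\<And>T. submodule T A M \<Longrightarrow> S \<subseteq> T \<Longrightarrow> U \<subseteq> T"
    using noetherian_submodule_carrier[OF A fg] U submodule_subset[OF U M]
    unfolding noetherian_submodule_def by metis
  then show ?thesis
    unfolding fg_module_def submodule_restrict_iff[OF U M]
    using right_module_restrict[OF U M] by (intro conjI exI[of _ S]) auto
qed

section \<open>Existence and transport of resolutions\<close>

text \<open>The passage from the cohomology group to the extension property: composing
  \<open>g\<close> with the differential gives a cocycle, hence a coboundary \<open>h\<close> after
  the differential. As the differential is onto the kernel, \<open>h\<close> and \<open>g\<close>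
  agree there.\<close>

lemma Ext_trivialD:
  assumes R: "projective_resolution A M R" and m: "right_module A M" "right_module A Y"
    and t: "trivial_group ((Hom_group A (pr_mod R (Suc u)) Y)\<lparr>carrier := Ext_cocycles A R Y (Suc u)\<rparr> Mod Ext_coboundaries A R Y (Suc u))"
    and g: "g \<in> mod_hom A (pr_syzygy M R u) Y"
  obtains h where "h \<in> mod_hom A (pr_mod R u) Y" "\<And>x. x \<in> pr_kernel M R u \<Longrightarrow> h x = g x"
proof -
  let ?P = "pr_mod R (Suc u)" and ?B = "Ext_coboundaries A R Y (Suc u)"
  let ?G = "(Hom_group A ?P Y)\<lparr>carrier := Ext_cocycles A R Y (Suc u)\<rparr>"
  have P: "right_module A (pr_mod R i)" for i
    using R by (simp add: projective_resolution_def projective_module_def)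
  interpret Y: right_module A Y by fact
  have d: "pr_diff R i \<in> mod_hom A (pr_mod R (Suc i)) (pr_mod R i)"
    and im: "pr_diff R i ` carrier (pr_mod R (Suc i)) = pr_kernel M R i" for i
    using R by (simp_all add: projective_resolution_def)
  have dK: "pr_diff R u x \<in> pr_kernel M R u" if "x \<in> carrier ?P" for x
    using im that by blast
  define c where "c = compose (carrier ?P) g (pr_diff R u)"
  have c: "c \<in> mod_hom A ?P Y"
    unfolding c_def by (rule mod_hom_compose[OF mod_hom_corestrict[OF d dK] g P])
  have "c (pr_diff R (Suc u) x) = \<zero>\<^bsub>Y\<^esub>" if "x \<in> carrier (pr_mod R (Suc (Suc u)))" for x
  proof -
    have "pr_diff R (Suc u) x \<in> carrier ?P" "pr_diff R u (pr_diff R (Suc u) x) = \<zero>\<^bsub>pr_mod R u\<^esub>"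
      using im[of "Suc u"] that by (auto simp: a_kernel_def')
    moreover have "submodule (pr_kernel M R u) A (pr_mod R u)"
      using submodule_kernel[of "pr_aug R" A "pr_mod R 0" M] submodule_kernel[of "pr_diff R _" A "pr_mod R (Suc _)" "pr_mod R _"] R m(1) P
      by (cases u) (simp_all add: projective_resolution_def)
    ultimately show ?thesis
      using mod_hom_zero[OF g right_module_restrict[OF _ P] m(2)] by (simp add: c_def compose_def)
  qed
  then have cc: "c \<in> Ext_cocycles A R Y (Suc u)" using c by (simp add: Ext_cocycles_def)
  have z: "(\<lambda>x\<in>carrier ?P. \<zero>\<^bsub>Y\<^esub>) \<in> ?B"
  proof -
    have "(\<lambda>x\<in>carrier ?P. \<zero>\<^bsub>Y\<^esub>) = compose (carrier ?P) (\<lambda>x\<in>carrier (pr_mod R u). \<zero>\<^bsub>Y\<^esub>) (pr_diff R u)"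
      using mod_hom_closed[OF d] by (auto simp: compose_def restrict_def)
    then show ?thesis using mod_hom_const_zero[OF P m(2), of u] by auto
  qed
  \<comment> \<open>The only coset is \<open>?B\<close> itself, so the coset of \<open>c\<close> is
    \<open>?B\<close>; since the zero map belongs to \<open>?B\<close>, this coset contains
    \<open>c\<close>.\<close>
  have "carrier (?G Mod ?B) = {?B}" using t by (simp add: trivial_group_def FactGroup_def)
  then have "?B #>\<^bsub>?G\<^esub> c = ?B" using cc by (auto simp: FactGroup_def RCOSETS_def)
  moreover have "(\<lambda>x\<in>carrier ?P. \<zero>\<^bsub>Y\<^esub>) \<otimes>\<^bsub>?G\<^esub> c = c"
    using mod_hom_closed[OF c] mod_hom_ext[OF c]
    by (auto simp: Hom_group_def extensional_def restrict_def)
  ultimately have "c \<in> ?B" using z unfolding r_coset_def by blast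
  then obtain h where h: "h \<in> mod_hom A (pr_mod R u) Y" "c = compose (carrier ?P) h (pr_diff R u)"
    by (simp only: Ext_coboundaries.simps) blast
  have "h x = g x" if x: "x \<in> pr_kernel M R u" for x
  proof -
    obtain y where y: "y \<in> carrier ?P" "x = pr_diff R u y"
      using x unfolding im[symmetric] by auto
    have "c y = g x" using y by (simp add: c_def compose_def)
    moreover have "c y = h x" unfolding h(2) using y by (simp add: compose_def)
    ultimately show ?thesis by simp
  qed
  then show thesis using that h(1) by blast
qed

text \<open>Only the augmentation is altered. Along an isomorphism all kernels therefore stay equal
  as sets, and extension problems carry over verbatim.\<close>

definition res_transport :: "('m \<Rightarrow> 'n) \<Rightarrow> ('a, 'm) proj_res \<Rightarrow> ('a, 'n) proj_res"
  where "res_transport f R = \<lparr>pr_mod = pr_mod R, pr_diff = pr_diff R,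
    pr_aug = compose (carrier (pr_mod R 0)) f (pr_aug R)\<rparr>"

lemma res_transport:
  assumes R: "projective_resolution A M R" and m: "right_module A M" "right_module A N"
    and f: "f \<in> mod_hom A M N" and g: "g \<in> mod_hom A N M"
    and gf: "\<And>x. x \<in> carrier M \<Longrightarrow> g (f x) = x" and fg: "\<And>y. y \<in> carrier N \<Longrightarrow> f (g y) = y"
  shows "pr_kernel N (res_transport f R) i = pr_kernel M R i"
    and "projective_resolution A N (res_transport f R)"
proof -
  have P: "right_module A (pr_mod R i)" for i
    using R by (simp add: projective_resolution_def projective_module_def)
  have a: "pr_aug R \<in> mod_hom A (pr_mod R 0) M" using R by (simp add: projective_resolution_def)
  have "f x = \<zero>\<^bsub>N\<^esub> \<longleftrightarrow> x = \<zero>\<^bsub>M\<^esub>" if "x \<in> carrier M" for x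
    using gf[OF that] mod_hom_zero[OF f m] mod_hom_zero[OF g m(2,1)] by metis
  then show k: "pr_kernel N (res_transport f R) i = pr_kernel M R i" for i
    using mod_hom_closed[OF a] by (cases i) (auto simp: res_transport_def a_kernel_def' compose_def)
  have "f ` carrier M = carrier N"
    using mod_hom_closed[OF f] mod_hom_closed[OF g] fg by (metis image_eqI image_subsetI subsetI subset_antisym)
  moreover have "pr_aug R ` carrier (pr_mod R 0) = carrier M" using R by (simp add: projective_resolution_def)
  ultimately have "f ` pr_aug R ` carrier (pr_mod R 0) = carrier N" by simp
  then have "compose (carrier (pr_mod R 0)) f (pr_aug R) ` carrier (pr_mod R 0) = carrier N"
    by (simp add: compose_def image_image)
  then show "projective_resolution A N (res_transport f R)"
    using R mod_hom_compose[OF a f P] unfolding projective_resolution_def k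
    by (simp add: res_transport_def)
qed

lemma projective_cover_fg:
  fixes P :: "'a univ_module" and M :: "'a univ_module"
  assumes c: "projective_cover A P p M" and fg: "fg_module A M"
  shows "fg_module A P"
proof -
  have p: "p \<in> mod_hom A P M" "p ` carrier P = carrier M" and s: "superfluous A P (a_kernel P M p)"
    and P: "right_module A P"
    using c by (simp_all add: projective_cover_def projective_module_def)
  interpret P: right_module A P by fact
  obtain S where M: "right_module A M" and S: "finite S" "S \<subseteq> carrier M"
    "\<And>U. submodule U A M \<Longrightarrow> S \<subseteq> U \<Longrightarrow> U = carrier M"
    by (rule fg_moduleE[OF fg]) blast
  interpret M: right_module A M by fact
  obtain T where T: "finite T" "T \<subseteq> carrier P" "S = p ` T"
    using finite_subset_image[OF S(1)] S(2) p(2) by metis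
  have "W = carrier P" if W: "submodule W A P" "T \<subseteq> W" for W
  proof -
    note Wc = submodule_carrier[OF W(1) P]
    have "submodule (restrict p W ` carrier (restrict_module P W)) A M"
      by (rule submodule_image[OF mod_hom_restrict[OF p(1) P W(1)] right_module_restrict[OF W(1) P] M])
    then have "p ` W = carrier M" using W(2) T(3) by (intro S(3)) auto
    have "carrier P \<subseteq> a_kernel P M p <+>\<^bsub>P\<^esub> W"
    proof
      fix x assume x: "x \<in> carrier P"
      then obtain w where w: "w \<in> W" "p x = p w"
        using \<open>p ` W = carrier M\<close> mod_hom_closed[OF p(1) x] by (metis imageE)
      have "p (x \<ominus>\<^bsub>P\<^esub> w) = \<zero>\<^bsub>M\<^esub>"
        using x w Wc mod_hom_closed[OF p(1) x] M.M.r_neg mod_hom_minus[OF p(1) P M x, of w]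
        by (simp add: a_minus_def[of M])
      then have "x \<ominus>\<^bsub>P\<^esub> w \<in> a_kernel P M p" using x w Wc by (simp add: a_kernel_def')
      moreover have "x = (x \<ominus>\<^bsub>P\<^esub> w) \<oplus>\<^bsub>P\<^esub> w"
        using x w Wc by (simp add: a_minus_def P.M.a_assoc P.M.l_neg)
      ultimately show "x \<in> a_kernel P M p <+>\<^bsub>P\<^esub> W" unfolding set_add_def' using w(1) by blast
    qed
    moreover have "a_kernel P M p <+>\<^bsub>P\<^esub> W \<subseteq> carrier P"
      using Wc by (auto simp: set_add_def' a_kernel_def')
    ultimately show ?thesis using s W(1) unfolding superfluous_def by blast
  qed
  then show ?thesis unfolding fg_module_def using P T by blast
qed

text \<open>Iterate a fixed choice of cover: semiperfectness supplies it for each finitely generated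
  module, and noetherianity keeps its kernel finitely generated.\<close>

lemma minimal_resolution_exists:
  fixes M :: "'a univ_module"
  assumes A: "right_noetherian A" "semiperfect A" and fg: "fg_module A M"
  shows "\<exists>R. minimal_projective_resolution A M R"
proof -
  define c :: "'a univ_module \<Rightarrow> 'a univ_module \<times> ('a list \<Rightarrow> 'a list)"
    where "c X = (SOME z. projective_cover A (fst z) (snd z) X)" for X
  have c: "projective_cover A (fst (c X)) (snd (c X)) X" if "fg_module A X" for X
  proof -
    have "\<exists>z :: 'a univ_module \<times> ('a list \<Rightarrow> 'a list). projective_cover A (fst z) (snd z) X"
    proof -
      have "\<exists>(P :: 'a univ_module) p. projective_cover A P p X"
        using A(2)[unfolded semiperfect_def, rule_format, OF that] .
      then show ?thesis by simp
    qed
    from someI_ex[OF this] show ?thesis by (simp add: c_def)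
  qed
  define K where "K X = restrict_module (fst (c X)) (a_kernel (fst (c X)) X (snd (c X)))" for X
  have K: "fg_module A (K X)" if X: "fg_module A X" for X
  proof -
    have "snd (c X) \<in> mod_hom A (fst (c X)) X" "right_module A (fst (c X))"
      using c[OF X] by (simp_all add: projective_cover_def projective_module_def)
    then show ?thesis
      unfolding K_def using projective_cover_fg[OF c[OF X] X] fg_right_module[OF X]
      by (intro fg_submodule[OF A(1)] submodule_kernel)
  qed
  define X where "X i = (K ^^ i) M" for i
  have X: "fg_module A (X i)" for i
    by (induction i) (use fg K in \<open>simp_all add: X_def\<close>)
  note cX = c[OF X]
  define R where "R = \<lparr>pr_mod = (\<lambda>i. fst (c (X i))), pr_diff = (\<lambda>i. snd (c (X (Suc i)))), pr_aug = snd (c M)\<rparr>"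
  have XS: "X (Suc i) = K (X i)" "X 0 = M" for i by (simp_all add: X_def)
  \<comment> \<open>An equality of records and not just an isomorphism, so the cover chosen for
    \<open>X (Suc i)\<close> is literally a cover of the syzygy in \<open>R\<close>.\<close>
  have syz: "pr_syzygy M R i = X (Suc i)" for i
  proof (cases i)
    case (Suc j)
    show ?thesis unfolding Suc XS(1)[of "Suc j"] K_def
      by (simp add: R_def a_kernel_def') (simp add: XS K_def)
  qed (simp add: R_def XS K_def)
  have ker: "pr_kernel M R i = carrier (X (Suc i))" for i
    using arg_cong[OF syz[of i], of carrier] by simp
  have pc: "projective_cover A (pr_mod R (Suc i)) (pr_diff R i) (pr_syzygy M R i)" for i
    unfolding syz using cX by (simp add: R_def)
  have pc0: "projective_cover A (pr_mod R 0) (pr_aug R) M" using cX[of 0] by (simp add: R_def XS)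
  have fgR: "fg_module A (pr_mod R i)" "projective_module A (pr_mod R i)" for i
    using projective_cover_fg[OF cX X, of i] cX[of i] by (simp_all add: R_def projective_cover_def)
  have "pr_diff R i \<in> mod_hom A (pr_mod R (Suc i)) (pr_mod R i)" for i
  proof (rule mod_hom_uncorestrict)
    show "pr_diff R i \<in> mod_hom A (pr_mod R (Suc i)) (pr_syzygy M R i)"
      using pc by (simp add: projective_cover_def)
    show "pr_kernel M R i \<subseteq> carrier (pr_mod R i)" by (cases i) (auto simp: a_kernel_def')
  qed
  moreover have "pr_diff R i ` carrier (pr_mod R (Suc i)) = pr_kernel M R i" for i
    using pc[of i] by (simp add: projective_cover_def)
  ultimately have "projective_resolution A M R"
    using pc0 fgR by (simp add: projective_resolution_def projective_cover_def)
  then show ?thesis using pc pc0 unfolding minimal_projective_resolution_def by blast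
qed

section \<open>Vanishing of Ext into projective modules\<close>

lemma zero_module_projective:
  assumes Z: "right_module A Z" "zero_module Z"
  shows "projective_module A Z"
  unfolding projective_module_def
proof (intro conjI allI ballI impI Z)
  fix X Y :: "'a univ_module" and g f
  assume g: "g \<in> mod_hom A X Y" and f: "f \<in> mod_hom A Z Y"
    and "right_module A X \<and> right_module A Y \<and> g ` carrier X = carrier Y"
  then have m: "right_module A X" "right_module A Y" by auto
  show "\<exists>h\<in>mod_hom A Z X. \<forall>x\<in>carrier Z. g (h x) = f x"
    using Z(2) mod_hom_zero[OF f Z(1) m(2)] mod_hom_zero[OF g m]
    by (intro bexI[OF _ mod_hom_const_zero[OF Z(1) m(1)]]) (simp add: zero_module_def)
qed

lemma zero_submodule:
  assumes "right_module A M"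
  shows "right_module A (restrict_module M {\<zero>\<^bsub>M\<^esub>})" "projective_module A (restrict_module M {\<zero>\<^bsub>M\<^esub>})"
    "fg_module A (restrict_module M {\<zero>\<^bsub>M\<^esub>})" "zero_module (restrict_module M {\<zero>\<^bsub>M\<^esub>})"
proof -
  note s = submodule_zero_self[OF assms]
  show 1: "right_module A (restrict_module M {\<zero>\<^bsub>M\<^esub>})" by (rule right_module_restrict[OF s assms])
  show "zero_module (restrict_module M {\<zero>\<^bsub>M\<^esub>})" by (simp add: zero_module_def)
  then show "projective_module A (restrict_module M {\<zero>\<^bsub>M\<^esub>})" by (rule zero_module_projective[OF 1])
  show "fg_module A (restrict_module M {\<zero>\<^bsub>M\<^esub>})"
    unfolding fg_module_def submodule_restrict_iff[OF s assms]
    using 1 submodule_zero[OF _ assms] by (intro conjI exI[of _ "{}"]) auto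
qed

text \<open>Says that a retract of the direct sum of \<open>P\<close> and \<open>Q\<close> is
  projective, without forming that sum: lift on each factor and add.\<close>

lemma projective_retract_sum:
  assumes V: "right_module A V" and P: "projective_module A P" "projective_module A Q"
    and h: "a \<in> mod_hom A V P" "b \<in> mod_hom A P V" "c \<in> mod_hom A V Q" "d \<in> mod_hom A Q V"
    and eq: "\<And>v. v \<in> carrier V \<Longrightarrow> v = b (a v) \<oplus>\<^bsub>V\<^esub> d (c v)"
  shows "projective_module A V"
  unfolding projective_module_def
proof (intro conjI allI ballI impI V)
  fix X Y :: "'a univ_module" and g f
  assume g: "g \<in> mod_hom A X Y" and f: "f \<in> mod_hom A V Y"
    and "right_module A X \<and> right_module A Y \<and> g ` carrier X = carrier Y"
  then have m: "right_module A X" "right_module A Y" and s: "g ` carrier X = carrier Y" by auto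
  note mP = P[THEN projective_right_module]
  obtain k where k: "k \<in> mod_hom A P X" "\<And>x. x \<in> carrier P \<Longrightarrow> g (k x) = compose (carrier P) f b x"
    using projectiveD[OF P(1) g s mod_hom_compose[OF h(2) f mP(1)] m] by blast
  obtain l where l: "l \<in> mod_hom A Q X" "\<And>x. x \<in> carrier Q \<Longrightarrow> g (l x) = compose (carrier Q) f d x"
    using projectiveD[OF P(2) g s mod_hom_compose[OF h(4) f mP(2)] m] by blast
  let ?h = "\<lambda>x\<in>carrier V. compose (carrier V) k a x \<oplus>\<^bsub>X\<^esub> compose (carrier V) l c x"
  have "?h \<in> mod_hom A V X"
    by (intro mod_hom_sum mod_hom_compose[OF h(1) k(1)] mod_hom_compose[OF h(3) l(1)] V m)
  moreover have "g (?h v) = f v" if v: "v \<in> carrier V" for v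
  proof -
    note av = mod_hom_closed[OF h(1) v] and cv = mod_hom_closed[OF h(3) v]
    have "f v = f (b (a v)) \<oplus>\<^bsub>Y\<^esub> f (d (c v))"
      using arg_cong[OF eq[OF v], of f] mod_hom_add[OF f mod_hom_closed[OF h(2) av] mod_hom_closed[OF h(4) cv]]
      by simp
    then show ?thesis
      using v av cv k(2)[OF av] l(2)[OF cv] mod_hom_add[OF g mod_hom_closed[OF k(1) av] mod_hom_closed[OF l(1) cv]]
      by (simp add: compose_def)
  qed
  ultimately show "\<exists>h\<in>mod_hom A V X. \<forall>x\<in>carrier V. g (h x) = f x" by blast
qed

text \<open>A strict retraction is the case of zero error, routed through the zero module.\<close>

lemma stable_retractI:
  assumes m: "right_module A X'" and f: "f \<in> mod_hom A X' X" and g: "g \<in> mod_hom A X X'"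
    and gf: "\<And>x. x \<in> carrier X' \<Longrightarrow> g (f x) = x"
  shows "stable_retract A X' X"
proof -
  let ?Q = "restrict_module X' {\<zero>\<^bsub>X'\<^esub>}"
  interpret X': right_module A X' by fact
  have "\<forall>x\<in>carrier X'. g (f x) = x \<oplus>\<^bsub>X'\<^esub> (\<lambda>x\<in>carrier ?Q. \<zero>\<^bsub>X'\<^esub>) ((\<lambda>x\<in>carrier X'. \<zero>\<^bsub>?Q\<^esub>) x)"
    using gf by simp
  then show ?thesis
    unfolding stable_retract_def
    using f g zero_submodule[OF m] mod_hom_const_zero[OF m zero_submodule(1)[OF m]]
      mod_hom_const_zero[OF zero_submodule(1)[OF m] m] by blast
qed

text \<open>The range of \<open>i\<close> is one short of the optimal \<open>i \<ge> n\<close>; it suffices because the dimension shift in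
  the second variable uses only \<open>Ext\<close> groups into projectives of degree at least \<open>n + 2\<close>.\<close>

lemma ext_vanish_regular:
  assumes A: "ring A" and id: "inj_dim A (regular_module A) = enat n"
    and X: "right_module A X" and R: "projective_resolution A X R" and i: "i > n"
  shows "ext_vanish A X R i (regular_module A)"
proof -
  let ?S = "{enat d |d. \<exists>R. injective_resolution A (regular_module A) R \<and> (\<forall>i > d. zero_module (ir_mod R i))}"
  \<comment> \<open>An empty infimum would be infinite. So the infimum is attained, and a resolution
    that vanishes beyond degree \<open>n\<close> itself is available.\<close>
  have "?S \<noteq> {}"
  proof
    assume "?S = {}"
    then have "inj_dim A (regular_module A) = \<infinity>" unfolding inj_dim_def by (simp only: Inf_enat_def if_True simp_thms)
    then show False using id by simp
  qed
  then have "Inf ?S \<in> ?S" unfolding Inf_enat_def by (metis (no_types, lifting) LeastI ex_in_conv)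
  then have "enat n \<in> ?S" using id unfolding inj_dim_def by simp
  then obtain I where I: "injective_resolution A (regular_module A) I" and z: "zero_module (ir_mod I (Suc n))"
    by auto
  let ?I = "ir_mod I" and ?d = "ir_diff I"
  define K where "K m = a_kernel (?I m) (?I (Suc m)) (?d m)" for m
  let ?C = "\<lambda>m. restrict_module (?I m) (K m)"
  have inj: "injective_module A (?I m)" for m using I by (simp add: injective_resolution_def)
  have mI: "right_module A (?I m)" for m using inj by (simp add: injective_module_def)
  have d: "?d m \<in> mod_hom A (?I m) (?I (Suc m))" for m using I by (simp add: injective_resolution_def)
  have sK: "submodule (K m) A (?I m)" for m unfolding K_def by (rule submodule_kernel[OF d mI mI])
  have mC: "right_module A (?C m)" for m by (rule right_module_restrict[OF sK mI])
  have dim: "?d m ` carrier (?I m) = K (Suc m)" for m using I by (simp add: injective_resolution_def K_def)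
  have dC: "?d m \<in> mod_hom A (?I m) (?C (Suc m))" for m
  proof (rule mod_hom_corestrict[OF d])
    show "?d m x \<in> K (Suc m)" if "x \<in> carrier (?I m)" for x
      unfolding dim[symmetric] using that by blast
  qed
  have dker: "a_kernel (?I m) (?C (Suc m)) (?d m) = K m" for m by (simp add: K_def a_kernel_def')
  \<comment> \<open>Descends through the cosyzygies, starting from the zero module at position n +
    1. Each step towards \<open>I 0\<close> costs one degree of Ext, which is why the bound on
    \<open>i\<close> grows with \<open>j\<close>.\<close>
  have claim: "\<forall>i\<ge>j. ext_vanish A X R i (?C (Suc n - j))" if "j \<le> n" for j
    using that
  proof (induction j)
    case 0
    show ?case
    proof (intro allI impI ext_vanishI)
      fix i g assume g: "g \<in> mod_hom A (res_syz X R (Suc i)) (?C (Suc n - 0))"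
      have "K (Suc n) \<subseteq> {\<zero>\<^bsub>?I (Suc n)\<^esub>}" using submodule_subset[OF sK mI, of "Suc n"] z by (simp add: zero_module_def)
      then have "g x = \<zero>\<^bsub>?I (Suc n)\<^esub>" if "x \<in> carrier (res_syz X R (Suc i))" for x
        using mod_hom_closed[OF g that] by auto
      then show "\<exists>h\<in>mod_hom A (pr_mod R i) (?C (Suc n - 0)). \<forall>x\<in>carrier (res_syz X R (Suc i)). h x = g x"
        using mod_hom_const_zero[OF res_right_module[OF X R, of i] mC[of "Suc n"]] carrier_res_syz_Suc[OF X R]
        by (intro bexI[of _ "\<lambda>x\<in>carrier (pr_mod R i). \<zero>\<^bsub>?C (Suc n)\<^esub>"]) (auto simp del: res_syz.simps)
    qed
  next
    case (Suc j)
    define m where "m = n - j"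
    have m: "Suc n - Suc j = m" "Suc n - j = Suc m" using Suc.prems by (auto simp: m_def)
    show ?case
    proof (intro allI impI)
      fix i assume "Suc j \<le> i"
      then obtain i' where i': "i = Suc i'" "j \<le> i'" by (cases i) auto
      show "ext_vanish A X R i (?C (Suc n - Suc j))"
        unfolding m i'
      proof (rule ext_vanish_shift[OF X R mod_hom_incl[OF mI sK] _ dC _ _ mC mI mC ext_vanish_injective[OF X R inj]])
        show "ext_vanish A X R i' (?C (Suc m))" using Suc i' m by simp
      qed (auto simp: dim dker inj_on_def)
    qed
  qed
  \<comment> \<open>The claim stops at position 1. The last step uses the coaugmentation in place of
    an inclusion, because the regular module is not itself a submodule of
    \<open>?I 0\<close>.\<close>
  obtain i' where i': "i = Suc i'" "n \<le> i'" using i by (cases i) auto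
  have co: "ir_coaug I \<in> mod_hom A (regular_module A) (?I 0)" "inj_on (ir_coaug I) (carrier (regular_module A))"
    "ir_coaug I ` carrier (regular_module A) = K 0"
    using I by (simp_all add: injective_resolution_def K_def)
  show ?thesis unfolding i'
  proof (rule ext_vanish_shift[OF X R co(1,2) dC _ _ right_module_regular[OF A] mI mC ext_vanish_injective[OF X R inj]])
    show "ext_vanish A X R i' (?C (Suc 0))" using claim[of n] i' by simp
  qed (simp_all add: dim dker co)
qed

text \<open>Each coordinate of \<open>g\<close> is a homomorphism into the regular module; the
  finitely many extensions are reassembled into a list.\<close>

lemma ext_vanish_free:
  assumes A: "ring A" and X: "right_module A X" and R: "projective_resolution A X R"
    and v: "ext_vanish A X R i (regular_module A)"
  shows "ext_vanish A X R i (free_module A k)"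
proof (rule ext_vanishI)
  let ?S = "res_syz X R (Suc i)" and ?P = "pr_mod R i"
  fix g assume g: "g \<in> mod_hom A ?S (free_module A k)"
  note S = res_syz_right_module[OF X R, of "Suc i"] and P = res_right_module[OF X R, of i]
  interpret P: right_module A ?P by (rule P)
  note gc = mod_hom_closed[OF g, unfolded free_module_carrier_iff]
  have "\<exists>h. h \<in> mod_hom A ?P (regular_module A) \<and> (\<forall>x\<in>carrier ?S. h x = g x ! l)" if l: "l < k" for l
  proof -
    have "(\<lambda>x\<in>carrier ?S. g x ! l) \<in> mod_hom A ?S (regular_module A)"
    proof (rule mod_hom_restrictI[OF S])
      fix x assume "x \<in> carrier ?S"
      then show "g x ! l \<in> carrier (regular_module A)" using gc l by (simp add: regular_module_def)
    next
      fix x y assume xy: "x \<in> carrier ?S" "y \<in> carrier ?S"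
      then show "g (x \<oplus>\<^bsub>?S\<^esub> y) ! l = g x ! l \<oplus>\<^bsub>regular_module A\<^esub> g y ! l"
        using l gc[of x] gc[of y] unfolding mod_hom_add[OF g xy] free_module_simps
        by (simp add: regular_module_def del: res_syz.simps)
    next
      fix a x assume ax: "a \<in> carrier A" "x \<in> carrier ?S"
      then show "g (a \<odot>\<^bsub>?S\<^esub> x) ! l = a \<odot>\<^bsub>regular_module A\<^esub> g x ! l"
        using l gc[of x] unfolding mod_hom_smult[OF g ax] free_module_simps
        by (simp add: regular_module_def del: res_syz.simps)
    qed
    then obtain h where "h \<in> mod_hom A ?P (regular_module A)"
      "\<And>x. x \<in> carrier ?S \<Longrightarrow> h x = (\<lambda>x\<in>carrier ?S. g x ! l) x"
      by (rule ext_vanishD[OF v]) blast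
    then show ?thesis by (intro exI[of _ h]) simp
  qed
  then obtain h where h: "\<And>l. l < k \<Longrightarrow> h l \<in> mod_hom A ?P (regular_module A)"
    "\<And>l x. l < k \<Longrightarrow> x \<in> carrier ?S \<Longrightarrow> h l x = g x ! l" by metis
  let ?h = "\<lambda>x\<in>carrier ?P. map (\<lambda>l. h l x) [0..<k]"
  have hc: "h l x \<in> carrier A" if "l < k" "x \<in> carrier ?P" for l x
    using mod_hom_closed[OF h(1) that(2)] that(1) by (simp add: regular_module_def)
  have "?h \<in> mod_hom A ?P (free_module A k)"
  proof (rule mod_hom_restrictI[OF P])
    fix x y assume "x \<in> carrier ?P" "y \<in> carrier ?P"
    then show "map (\<lambda>l. h l (x \<oplus>\<^bsub>?P\<^esub> y)) [0..<k] =
        map (\<lambda>l. h l x) [0..<k] \<oplus>\<^bsub>free_module A k\<^esub> map (\<lambda>l. h l y) [0..<k]"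
      unfolding free_module_simps using mod_hom_add[OF h(1)]
      by (intro nth_equalityI) (simp_all add: regular_module_def)
  next
    fix a x assume "a \<in> carrier A" "x \<in> carrier ?P"
    then show "map (\<lambda>l. h l (a \<odot>\<^bsub>?P\<^esub> x)) [0..<k] = a \<odot>\<^bsub>free_module A k\<^esub> map (\<lambda>l. h l x) [0..<k]"
      unfolding free_module_simps using mod_hom_smult[OF h(1)]
      by (intro nth_equalityI) (simp_all add: regular_module_def)
  qed (simp add: free_module_carrier_iff hc)
  moreover have "?h x = g x" if x: "x \<in> carrier ?S" for x
    using x carrier_res_syz_Suc[OF X R, of x i] h(2)[OF _ x] gc[OF x]
    by (auto intro!: nth_equalityI simp del: res_syz.simps)
  ultimately show "\<exists>h\<in>mod_hom A ?P (free_module A k). \<forall>x\<in>carrier ?S. h x = g x" by blast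
qed

text \<open>A finitely generated projective module is a retract of a finite free one: the identity
  lifts along a free cover.\<close>

lemma ext_vanish_projective:
  fixes P :: "'a univ_module"
  assumes A: "ring A" and id: "inj_dim A (regular_module A) = enat n"
    and X: "right_module A X" and R: "projective_resolution A X R" and i: "i > n"
    and P: "projective_module A P" "fg_module A P"
  shows "ext_vanish A X R i P"
proof -
  note mP = projective_right_module[OF P(1)] and mF = right_module_free[OF A]
  obtain k p where p: "p \<in> mod_hom A (free_module A k) P" "p ` carrier (free_module A k) = carrier P"
    using fg_free_cover[OF P(2)] .
  obtain s where s: "s \<in> mod_hom A P (free_module A k)" "\<And>x. x \<in> carrier P \<Longrightarrow> p (s x) = (\<lambda>x\<in>carrier P. x) x"
    using projectiveD[OF P(1) p mod_hom_id[OF mP] mF mP] by blast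
  show ?thesis
    by (rule ext_vanish_retract[OF X R ext_vanish_free[OF A X R ext_vanish_regular[OF A id X R i]] s(1) p(1)])
      (simp add: s(2))
qed

text \<open>Shift in the second variable along 0 -> \<open>res_syz X R (Suc j)\<close> ->
  \<open>pr_mod R j\<close> -> \<open>res_syz X R j\<close> -> 0. The Ext group into the middle term
  has degree j + i + 2, which is at least n + 2. The added \<open>j\<close> is removed again by
  \<open>ext_vanish_drop\<close>.\<close>

lemma ext_vanish_syz:
  assumes A: "ring A" and id: "inj_dim A (regular_module A) = enat n"
    and X: "right_module A X" and R: "projective_resolution A X R"
    and v: "\<And>i. i \<ge> n \<Longrightarrow> ext_vanish A X R i X" and i: "i \<ge> n"
  shows "ext_vanish A X R (j + i) (res_syz X R j)"
proof (induction j)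
  case (Suc j)
  let ?K = "a_kernel (pr_mod R j) (res_syz X R j) (res_map R j)"
  note m = res_syz_right_module[OF X R] res_right_module[OF X R]
  have "ext_vanish A X R (Suc (j + i)) (pr_mod R j)"
    using i by (intro ext_vanish_projective[OF A id X R _ res_projective[OF X R] res_fg[OF X R]]) simp
  then have "ext_vanish A X R (Suc (j + i)) (restrict_module (pr_mod R j) ?K)"
    by (intro ext_vanish_shift[OF X R mod_hom_incl[OF m(2) res_kernel_submodule[OF X R]] _
      res_map_hom[OF X R] res_map_surj[OF X R] _ _ m(2,1) _ Suc])
      (auto simp: inj_on_def right_module_restrict[OF res_kernel_submodule[OF X R] m(2)])
  then show ?case using res_syz_Suc[OF X R, of j] by (simp del: res_syz.simps)
qed (use v i in simp)

section \<open>Direct sums and finite resolutions\<close>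

lemma internal_direct_sum_mem:
  assumes ds: "internal_direct_sum A Z U V" and m: "right_module A Z"
  shows "z \<in> carrier Z \<Longrightarrow> \<exists>u\<in>U. \<exists>v\<in>V. z = u \<oplus>\<^bsub>Z\<^esub> v"
    and "u \<in> U \<Longrightarrow> v \<in> V \<Longrightarrow> u' \<in> U \<Longrightarrow> v' \<in> V \<Longrightarrow> u \<oplus>\<^bsub>Z\<^esub> v = u' \<oplus>\<^bsub>Z\<^esub> v' \<Longrightarrow> u = u' \<and> v = v'"
proof -
  interpret Z: right_module A Z by fact
  have s: "submodule U A Z" "submodule V A Z" and I: "U \<inter> V = {\<zero>\<^bsub>Z\<^esub>}" and S: "U <+>\<^bsub>Z\<^esub> V = carrier Z"
    using ds by (simp_all add: internal_direct_sum_def)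
  show "\<exists>u\<in>U. \<exists>v\<in>V. z = u \<oplus>\<^bsub>Z\<^esub> v" if "z \<in> carrier Z"
    using that unfolding S[symmetric] set_add_def' by blast
  assume uv: "u \<in> U" "v \<in> V" "u' \<in> U" "v' \<in> V" and e: "u \<oplus>\<^bsub>Z\<^esub> v = u' \<oplus>\<^bsub>Z\<^esub> v'"
  note c = submodule_carrier[OF s(1) m uv(1)] submodule_carrier[OF s(1) m uv(3)]
    submodule_carrier[OF s(2) m uv(2)] submodule_carrier[OF s(2) m uv(4)]
  have "u \<ominus>\<^bsub>Z\<^esub> u' = v' \<ominus>\<^bsub>Z\<^esub> v"
  proof -
    have "u \<ominus>\<^bsub>Z\<^esub> u' = (u \<oplus>\<^bsub>Z\<^esub> v) \<ominus>\<^bsub>Z\<^esub> v \<ominus>\<^bsub>Z\<^esub> u'"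
      using c by (simp add: a_minus_def Z.M.a_ac Z.M.r_neg Z.M.r_neg2)
    also have "\<dots> = u' \<oplus>\<^bsub>Z\<^esub> (\<ominus>\<^bsub>Z\<^esub> u' \<oplus>\<^bsub>Z\<^esub> (v' \<ominus>\<^bsub>Z\<^esub> v))"
      unfolding e using c by (simp add: a_minus_def Z.M.a_ac)
    also have "\<dots> = v' \<ominus>\<^bsub>Z\<^esub> v"
      using c by (intro Z.M.r_neg2) simp_all
    finally show ?thesis .
  qed
  then have "u \<ominus>\<^bsub>Z\<^esub> u' \<in> U \<inter> V" "v' \<ominus>\<^bsub>Z\<^esub> v \<in> U \<inter> V"
    using submodule_minus[OF s(1) m uv(1,3)] submodule_minus[OF s(2) m uv(4,2)] by simp_all
  then show "u = u' \<and> v = v'"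
    unfolding I using minus_eq_zeroD[OF Z.M.abelian_group_axioms] c by (metis singletonD)
qed

lemma internal_direct_sum_commute:
  assumes ds: "internal_direct_sum A Z U V" and m: "right_module A Z"
  shows "internal_direct_sum A Z V U"
proof -
  interpret Z: right_module A Z by fact
  have s: "submodule U A Z" "submodule V A Z" using ds by (simp_all add: internal_direct_sum_def)
  have "V <+>\<^bsub>Z\<^esub> U = U <+>\<^bsub>Z\<^esub> V"
    unfolding set_add_def' using submodule_carrier[OF s(1) m] submodule_carrier[OF s(2) m] Z.M.a_comm by fastforce
  then show ?thesis using ds by (auto simp: internal_direct_sum_def)
qed

text \<open>The components are chosen separately for every element; uniqueness of the decomposition
  is what makes them linear.\<close>

lemma internal_direct_sum_projection:
  assumes ds: "internal_direct_sum A Z U V" and m: "right_module A Z"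
  obtains p q where "p \<in> mod_hom A Z (restrict_module Z U)" "q \<in> mod_hom A Z (restrict_module Z V)"
    "\<And>z. z \<in> carrier Z \<Longrightarrow> z = p z \<oplus>\<^bsub>Z\<^esub> q z" "\<And>v. v \<in> V \<Longrightarrow> q v = v"
proof -
  interpret Z: right_module A Z by fact
  have s: "submodule U A Z" "submodule V A Z" using ds by (simp_all add: internal_direct_sum_def)
  note c = submodule_carrier[OF s(1) m] submodule_carrier[OF s(2) m]
  note uniq = internal_direct_sum_mem(2)[OF ds m]
  obtain p q where pq: "\<And>z. z \<in> carrier Z \<Longrightarrow> p z \<in> U \<and> q z \<in> V \<and> z = p z \<oplus>\<^bsub>Z\<^esub> q z"
    using internal_direct_sum_mem(1)[OF ds m] by metis
  have pc: "p z \<in> carrier Z" "q z \<in> carrier Z" if "z \<in> carrier Z" for z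
    using c pq[OF that] by blast+
  have add: "p (x \<oplus>\<^bsub>Z\<^esub> y) = p x \<oplus>\<^bsub>Z\<^esub> p y \<and> q (x \<oplus>\<^bsub>Z\<^esub> y) = q x \<oplus>\<^bsub>Z\<^esub> q y"
    if xy: "x \<in> carrier Z" "y \<in> carrier Z" for x y
  proof (rule uniq)
    have "p (x \<oplus>\<^bsub>Z\<^esub> y) \<oplus>\<^bsub>Z\<^esub> q (x \<oplus>\<^bsub>Z\<^esub> y) = (p x \<oplus>\<^bsub>Z\<^esub> q x) \<oplus>\<^bsub>Z\<^esub> (p y \<oplus>\<^bsub>Z\<^esub> q y)"
      using xy pq[of "x \<oplus>\<^bsub>Z\<^esub> y"] pq[OF xy(1)] pq[OF xy(2)] by simp
    also have "\<dots> = (p x \<oplus>\<^bsub>Z\<^esub> p y) \<oplus>\<^bsub>Z\<^esub> (q x \<oplus>\<^bsub>Z\<^esub> q y)"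
      using pc[OF xy(1)] pc[OF xy(2)] by (simp add: Z.M.a_ac)
    finally show "p (x \<oplus>\<^bsub>Z\<^esub> y) \<oplus>\<^bsub>Z\<^esub> q (x \<oplus>\<^bsub>Z\<^esub> y) = (p x \<oplus>\<^bsub>Z\<^esub> p y) \<oplus>\<^bsub>Z\<^esub> (q x \<oplus>\<^bsub>Z\<^esub> q y)" .
  qed (use pq xy submodule_add[OF s(1) m] submodule_add[OF s(2) m] in simp_all)
  have sm: "p (a \<odot>\<^bsub>Z\<^esub> x) = a \<odot>\<^bsub>Z\<^esub> p x \<and> q (a \<odot>\<^bsub>Z\<^esub> x) = a \<odot>\<^bsub>Z\<^esub> q x"
    if xy: "a \<in> carrier A" "x \<in> carrier Z" for a x
  proof (rule uniq)
    have "p (a \<odot>\<^bsub>Z\<^esub> x) \<oplus>\<^bsub>Z\<^esub> q (a \<odot>\<^bsub>Z\<^esub> x) = a \<odot>\<^bsub>Z\<^esub> (p x \<oplus>\<^bsub>Z\<^esub> q x)"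
      using xy pq[of "a \<odot>\<^bsub>Z\<^esub> x"] pq[OF xy(2)] Z.act_closed by simp
    also have "\<dots> = a \<odot>\<^bsub>Z\<^esub> p x \<oplus>\<^bsub>Z\<^esub> a \<odot>\<^bsub>Z\<^esub> q x"
      using pc[OF xy(2)] xy by (simp add: Z.act_add)
    finally show "p (a \<odot>\<^bsub>Z\<^esub> x) \<oplus>\<^bsub>Z\<^esub> q (a \<odot>\<^bsub>Z\<^esub> x) = a \<odot>\<^bsub>Z\<^esub> p x \<oplus>\<^bsub>Z\<^esub> a \<odot>\<^bsub>Z\<^esub> q x" .
  qed (use pq xy submodule_smult[OF s(1) m] submodule_smult[OF s(2) m] Z.act_closed in simp_all)
  show thesis
  proof (rule that)
    show "restrict p (carrier Z) \<in> mod_hom A Z (restrict_module Z U)"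
      "restrict q (carrier Z) \<in> mod_hom A Z (restrict_module Z V)"
      by (rule mod_hom_restrictI[OF m]; use pq add sm in simp)+
    show "z = restrict p (carrier Z) z \<oplus>\<^bsub>Z\<^esub> restrict q (carrier Z) z" if "z \<in> carrier Z" for z
      using that pq by simp
    show "restrict q (carrier Z) v = v" if "v \<in> V" for v
      using uniq[of "p v" "q v" "\<zero>\<^bsub>Z\<^esub>" v] pq[OF c(2)[OF that]] that c(2)[OF that] submodule_zero[OF s(1) m] by simp
  qed
qed

text \<open>Moves a summand of \<open>V\<close> over to its complement \<open>U\<close>, the step by
  which a complement is enlarged in the maximality argument.\<close>

lemma internal_direct_sum_assoc:
  assumes ds: "internal_direct_sum A Z U V" and m: "right_module A Z"
    and dV: "internal_direct_sum A (restrict_module Z V) V' W"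
  shows "internal_direct_sum A Z (U <+>\<^bsub>Z\<^esub> V') W" "U \<subseteq> U <+>\<^bsub>Z\<^esub> V'" "V' \<subseteq> U <+>\<^bsub>Z\<^esub> V'"
proof -
  interpret Z: right_module A Z by fact
  have s: "submodule U A Z" "submodule V A Z" and I: "U \<inter> V = {\<zero>\<^bsub>Z\<^esub>}" using ds by (simp_all add: internal_direct_sum_def)
  have s': "submodule V' A Z" "submodule W A Z" "V' \<subseteq> V" "W \<subseteq> V" "V' \<inter> W = {\<zero>\<^bsub>Z\<^esub>}"
    using dV submodule_restrict_iff[OF s(2) m] by (simp_all add: internal_direct_sum_def)
  note c = submodule_carrier[OF s(1) m] submodule_carrier[OF s(2) m] submodule_carrier[OF s'(1) m] submodule_carrier[OF s'(2) m]
  note mV = right_module_restrict[OF s(2) m]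
  let ?S = "U <+>\<^bsub>Z\<^esub> V'"
  have mem: "x \<in> ?S \<longleftrightarrow> (\<exists>u\<in>U. \<exists>v\<in>V'. x = u \<oplus>\<^bsub>Z\<^esub> v)" for x by (auto simp: set_add_def')
  show "U \<subseteq> ?S"
  proof
    fix u assume "u \<in> U"
    then have "u = u \<oplus>\<^bsub>Z\<^esub> \<zero>\<^bsub>Z\<^esub>" using c by simp
    then show "u \<in> ?S" using mem \<open>u \<in> U\<close> submodule_zero[OF s'(1) m] by blast
  qed
  show "V' \<subseteq> ?S"
  proof
    fix u assume "u \<in> V'"
    then have "u = \<zero>\<^bsub>Z\<^esub> \<oplus>\<^bsub>Z\<^esub> u" using c by simp
    then show "u \<in> ?S" using mem \<open>u \<in> V'\<close> submodule_zero[OF s(1) m] by blast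
  qed
  have "submodule ?S A Z" unfolding submodule_iff[OF m]
  proof (intro conjI ballI)
    show "?S \<subseteq> carrier Z" using mem c by auto
    show "\<zero>\<^bsub>Z\<^esub> \<in> ?S" using \<open>U \<subseteq> ?S\<close> submodule_zero[OF s(1) m] by blast
    show "x \<oplus>\<^bsub>Z\<^esub> y \<in> ?S" if xy: "x \<in> ?S" "y \<in> ?S" for x y
    proof -
      obtain u v u' v' where uv: "u \<in> U" "v \<in> V'" "u' \<in> U" "v' \<in> V'" "x = u \<oplus>\<^bsub>Z\<^esub> v" "y = u' \<oplus>\<^bsub>Z\<^esub> v'"
        using xy mem by blast
      then have "x \<oplus>\<^bsub>Z\<^esub> y = (u \<oplus>\<^bsub>Z\<^esub> u') \<oplus>\<^bsub>Z\<^esub> (v \<oplus>\<^bsub>Z\<^esub> v')" using c by (simp add: Z.M.a_ac)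
      then show ?thesis unfolding mem using uv submodule_add[OF s(1) m] submodule_add[OF s'(1) m] by blast
    qed
    show "a \<odot>\<^bsub>Z\<^esub> x \<in> ?S" if xy: "a \<in> carrier A" "x \<in> ?S" for a x
    proof -
      obtain u v where uv: "u \<in> U" "v \<in> V'" "x = u \<oplus>\<^bsub>Z\<^esub> v"
        using xy mem by blast
      then have "a \<odot>\<^bsub>Z\<^esub> x = a \<odot>\<^bsub>Z\<^esub> u \<oplus>\<^bsub>Z\<^esub> a \<odot>\<^bsub>Z\<^esub> v" using c xy(1) by (simp add: Z.act_add)
      then show ?thesis unfolding mem using uv xy(1) submodule_smult[OF s(1) m] submodule_smult[OF s'(1) m] by blast
    qed
  qed
  moreover have "x = \<zero>\<^bsub>Z\<^esub>" if x: "x \<in> ?S" "x \<in> W" for x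
  proof -
    obtain u v where uv: "u \<in> U" "v \<in> V'" "x = u \<oplus>\<^bsub>Z\<^esub> v" using x mem by blast
    have "u \<oplus>\<^bsub>Z\<^esub> v = \<zero>\<^bsub>Z\<^esub> \<oplus>\<^bsub>Z\<^esub> x" using uv c(4)[OF x(2)] by simp
    then have "v = x"
      using internal_direct_sum_mem(2)[OF ds m uv(1) _ submodule_zero[OF s(1) m], of v x] uv(2) x(2) s'(3,4) by blast
    then show ?thesis using uv(2) x(2) s'(5) by blast
  qed
  then have "?S \<inter> W = {\<zero>\<^bsub>Z\<^esub>}"
    using submodule_zero[OF \<open>submodule ?S A Z\<close> m] submodule_zero[OF s'(2) m] by blast
  moreover have "?S <+>\<^bsub>Z\<^esub> W = carrier Z"
  proof
    show "?S <+>\<^bsub>Z\<^esub> W \<subseteq> carrier Z"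
      using c submodule_carrier[OF \<open>submodule ?S A Z\<close> m] by (auto simp: set_add_def'[of Z ?S W])
    show "carrier Z \<subseteq> ?S <+>\<^bsub>Z\<^esub> W"
    proof
      fix z assume "z \<in> carrier Z"
      then obtain u v where uv: "u \<in> U" "v \<in> V" "z = u \<oplus>\<^bsub>Z\<^esub> v"
        using internal_direct_sum_mem(1)[OF ds m] by blast
      obtain v' w where vw: "v' \<in> V'" "w \<in> W" "v = v' \<oplus>\<^bsub>Z\<^esub> w"
        using internal_direct_sum_mem(1)[OF dV mV, of v] uv(2) by auto
      have "z = (u \<oplus>\<^bsub>Z\<^esub> v') \<oplus>\<^bsub>Z\<^esub> w" using uv vw c by (simp add: Z.M.a_assoc)
      then show "z \<in> ?S <+>\<^bsub>Z\<^esub> W" unfolding set_add_def'[of Z ?S W] using mem uv vw by blast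
    qed
  qed
  ultimately show "internal_direct_sum A Z ?S W"
    using s'(2) by (simp add: internal_direct_sum_def)
qed

lemma projective_internal_direct_sum:
  assumes m: "right_module A Z" and ds: "internal_direct_sum A Z U V"
    and P: "projective_module A (restrict_module Z U)" "projective_module A (restrict_module Z V)"
  shows "projective_module A Z"
proof -
  have s: "submodule U A Z" "submodule V A Z" using ds by (simp_all add: internal_direct_sum_def)
  obtain p q where pq: "p \<in> mod_hom A Z (restrict_module Z U)" "q \<in> mod_hom A Z (restrict_module Z V)"
    "\<And>z. z \<in> carrier Z \<Longrightarrow> z = p z \<oplus>\<^bsub>Z\<^esub> q z" "\<And>v. v \<in> V \<Longrightarrow> q v = v"
    by (rule internal_direct_sum_projection[OF ds m]) blast
  show ?thesis
  proof (rule projective_retract_sum[OF m P pq(1) mod_hom_incl[OF m s(1)] pq(2) mod_hom_incl[OF m s(2)]])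
    show "z = restrict (\<lambda>x. x) U (p z) \<oplus>\<^bsub>Z\<^esub> restrict (\<lambda>x. x) V (q z)" if "z \<in> carrier Z" for z
      using pq(3)[OF that] mod_hom_closed[OF pq(1) that] mod_hom_closed[OF pq(2) that] by simp
  qed
qed

lemma submodule_Union_chain:
  assumes m: "right_module A M" and C: "C \<noteq> {}" "subset.chain S C" "\<And>U. U \<in> S \<Longrightarrow> submodule U A M"
  shows "submodule (\<Union>C) A M"
proof -
  have sub: "submodule U A M" if "U \<in> C" for U using C(2,3) that by (auto simp: subset_chain_def)
  show ?thesis unfolding submodule_iff[OF m]
  proof (intro conjI ballI)
    show "x \<oplus>\<^bsub>M\<^esub> y \<in> \<Union>C" if xy: "x \<in> \<Union>C" "y \<in> \<Union>C" for x y
    proof -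
      obtain U V where UV: "U \<in> C" "V \<in> C" "x \<in> U" "y \<in> V" using xy by blast
      then have "U \<subseteq> V \<or> V \<subseteq> U" using C(2) by (auto simp: subset_chain_def)
      then obtain W where "W \<in> C" "x \<in> W" "y \<in> W" using UV by blast
      then show ?thesis using submodule_add[OF sub m] by blast
    qed
    show "\<zero>\<^bsub>M\<^esub> \<in> \<Union>C" using C(1) submodule_zero[OF sub m] by blast
  qed (use submodule_carrier[OF sub m] submodule_smult[OF sub m] in blast)+
qed

text \<open>Zorn's lemma applies because the union of a nonempty chain is finitely generated: its
  generators all lie in one member, which then is the whole union.\<close>

lemma noetherian_maximal:
  assumes A: "right_noetherian A" and fg: "fg_module A M"
    and S: "S \<noteq> {}" "\<And>U. U \<in> S \<Longrightarrow> submodule U A M"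
  obtains U where "U \<in> S" "\<And>V. V \<in> S \<Longrightarrow> U \<subseteq> V \<Longrightarrow> V = U"
proof -
  note m = fg_right_module[OF fg]
  have "\<exists>U\<in>S. \<forall>X\<in>C. X \<subseteq> U" if C: "subset.chain S C" for C
  proof (cases "C = {}")
    case False
    have u: "submodule (\<Union>C) A M" by (rule submodule_Union_chain[OF m False C S(2)])
    obtain F where F: "finite F" "F \<subseteq> \<Union>C" "\<And>T. submodule T A M \<Longrightarrow> F \<subseteq> T \<Longrightarrow> \<Union>C \<subseteq> T"
      using noetherian_submodule_carrier[OF A fg] u submodule_subset[OF u m]
      unfolding noetherian_submodule_def by metis
    obtain B where B: "B \<in> C" "F \<subseteq> B" using finite_subset_Union_chain[OF F(1,2) False C] .
    have "B \<in> S" using C B(1) by (auto simp: subset_chain_def)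
    then show ?thesis using F(3)[OF S(2) B(2)] by blast
  qed (use S(1) in blast)
  from subset_Zorn[of S, OF this] show thesis using that by metis
qed

text \<open>Take a complement \<open>U\<close> maximal among those whose partner \<open>V\<close> is
  not projective. If V splits, one part is not projective; adding the other part to \<open>U\<close>
  gives a complement of the same kind, so by maximality that other part is zero.\<close>

lemma nonprojective_indecomposable_summand:
  assumes A: "right_noetherian A" and fg: "fg_module A Z" and np: "\<not> projective_module A Z"
  obtains U V where "internal_direct_sum A Z U V" "indecomposable_module A (restrict_module Z V)"
    "\<not> projective_module A (restrict_module Z V)"
proof -
  note m = fg_right_module[OF fg]
  interpret Z: right_module A Z by (rule m)
  define S where "S = {U. \<exists>V. internal_direct_sum A Z U V \<and> \<not> projective_module A (restrict_module Z V)}"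
  have "{\<zero>\<^bsub>Z\<^esub>} \<in> S"
    unfolding S_def using np submodule_zero_self[OF m] submodule_carrier_self[OF m]
    by (auto simp: internal_direct_sum_def set_add_def' intro!: exI[of _ "carrier Z"])
  then have "S \<noteq> {}" by blast
  obtain U where U: "U \<in> S" "\<And>V. V \<in> S \<Longrightarrow> U \<subseteq> V \<Longrightarrow> V = U"
  proof (rule noetherian_maximal[OF A fg \<open>S \<noteq> {}\<close>])
    show "submodule U A Z" if "U \<in> S" for U using that by (auto simp: S_def internal_direct_sum_def)
  qed blast+
  then obtain V where V: "internal_direct_sum A Z U V" "\<not> projective_module A (restrict_module Z V)"
    by (auto simp: S_def)
  have sV: "submodule V A Z" "U \<inter> V = {\<zero>\<^bsub>Z\<^esub>}" using V by (simp_all add: internal_direct_sum_def)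
  note mV = right_module_restrict[OF sV(1) m]
  have triv: "V1 = {\<zero>\<^bsub>Z\<^esub>}" if ds: "internal_direct_sum A (restrict_module Z V) V1 V2"
    and np2: "\<not> projective_module A (restrict_module Z V2)" for V1 V2
  proof -
    note a = internal_direct_sum_assoc[OF V(1) m ds]
    have "U <+>\<^bsub>Z\<^esub> V1 = U" using a(1,2) np2 by (intro U(2)) (auto simp: S_def)
    moreover have "submodule V1 A Z" "V1 \<subseteq> V"
      using ds submodule_restrict_iff[OF sV(1) m] by (simp_all add: internal_direct_sum_def)
    ultimately show ?thesis using a(3) sV(2) submodule_zero[OF _ m] by blast
  qed
  have "V1 = {\<zero>\<^bsub>Z\<^esub>} \<or> V2 = {\<zero>\<^bsub>Z\<^esub>}" if ds: "internal_direct_sum A (restrict_module Z V) V1 V2" for V1 V2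
    using projective_internal_direct_sum[OF mV ds] V(2) triv[OF ds] triv[OF internal_direct_sum_commute[OF ds mV]]
    by auto
  moreover have "\<not> zero_module (restrict_module Z V)"
    using zero_module_projective[OF mV] V(2) by blast
  ultimately have "indecomposable_module A (restrict_module Z V)"
    by (auto simp: indecomposable_module_def)
  then show thesis using that V by blast
qed

text \<open>Keeps the resolution itself instead of an infimum in \<open>enat\<close>, so that it can
  be spliced and transported; the carrier type stays free, as the final step returns from lists to
  the type of \<open>M\<close>.\<close>

definition finite_resolution :: "('a, 'r) ring_scheme \<Rightarrow> ('a, 'm) module \<Rightarrow> bool"
  where "finite_resolution A M \<longleftrightarrow>
    (\<exists>d R. projective_resolution A M R \<and> (\<forall>i > d. zero_module (pr_mod R i)))"

lemma finite_resolution_projective: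
  fixes X :: "'a univ_module"
  assumes "projective_module A X" "fg_module A X"
  shows "finite_resolution A X"
proof -
  note m = projective_right_module[OF assms(1)]
  interpret X: right_module A X by (rule m)
  let ?Z = "restrict_module X {\<zero>\<^bsub>X\<^esub>}"
  define R where "R = \<lparr>pr_mod = (\<lambda>i. if i = 0 then X else ?Z), pr_diff = (\<lambda>i. \<lambda>x\<in>{\<zero>\<^bsub>X\<^esub>}. \<zero>\<^bsub>X\<^esub>),
    pr_aug = (\<lambda>x\<in>carrier X. x)\<rparr>"
  have k: "pr_kernel X R i = {\<zero>\<^bsub>X\<^esub>}" for i
    by (cases i) (auto simp: R_def a_kernel_def')
  have "projective_resolution A X R"
    unfolding projective_resolution_def k
    using assms zero_submodule[OF m] mod_hom_id[OF m] mod_hom_const_zero[OF zero_submodule(1)[OF m] m]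
      mod_hom_const_zero[OF zero_submodule(1)[OF m] zero_submodule(1)[OF m]]
    by (auto simp: R_def)
  then show ?thesis unfolding finite_resolution_def using zero_submodule(4)[OF m]
    by (intro exI[of _ 0] exI[of _ R]) (simp add: R_def)
qed

text \<open>Splices the cover in front of the resolution of its kernel: the old augmentation becomes
  the first differential and the length bound grows by one.\<close>

lemma finite_resolution_extend:
  fixes P X :: "'a univ_module"
  assumes P: "projective_module A P" "fg_module A P" and p: "p \<in> mod_hom A P X" "p ` carrier P = carrier X"
    and fin: "finite_resolution A (restrict_module P (a_kernel P X p))"
  shows "finite_resolution A X"
proof -
  let ?K = "restrict_module P (a_kernel P X p)"
  obtain d R where R: "projective_resolution A ?K R" "\<forall>i>d. zero_module (pr_mod R i)"
    using fin by (auto simp: finite_resolution_def)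
  define R' where "R' = \<lparr>pr_mod = (\<lambda>i. case i of 0 \<Rightarrow> P | Suc j \<Rightarrow> pr_mod R j),
    pr_diff = (\<lambda>i. case i of 0 \<Rightarrow> pr_aug R | Suc j \<Rightarrow> pr_diff R j), pr_aug = p\<rparr>"
  have k: "pr_kernel X R' (Suc i) = pr_kernel ?K R i" for i
    by (cases i) (simp_all add: R'_def a_kernel_def')
  have k0: "pr_kernel X R' 0 = carrier ?K" by (simp add: R'_def)
  have a: "pr_aug R \<in> mod_hom A (pr_mod R 0) P"
    by (rule mod_hom_uncorestrict[where N = P and U = "a_kernel P X p"])
      (use R(1) in \<open>auto simp: projective_resolution_def a_kernel_def'\<close>)
  have "pr_diff R' i \<in> mod_hom A (pr_mod R' (Suc i)) (pr_mod R' i) \<and>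
      pr_diff R' i ` carrier (pr_mod R' (Suc i)) = pr_kernel X R' i \<and>
      fg_module A (pr_mod R' i) \<and> projective_module A (pr_mod R' i)" for i
  proof (cases i)
    case 0
    then show ?thesis using R(1) a P unfolding 0 k0 by (simp add: R'_def projective_resolution_def)
  next
    case (Suc j)
    show ?thesis using R(1) unfolding Suc k by (simp add: R'_def projective_resolution_def)
  qed
  then have "projective_resolution A X R'"
    using p unfolding projective_resolution_def by (auto simp: R'_def)
  moreover have "\<forall>i > Suc d. zero_module (pr_mod R' i)"
    using R(2) by (auto simp: R'_def split: nat.split)
  ultimately show ?thesis unfolding finite_resolution_def by blast
qed

lemma finite_resolution_syz:
  assumes X: "right_module A X" "projective_resolution A X R" and P: "projective_module A (res_syz X R n)" "fg_module A (res_syz X R n)"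
  shows "finite_resolution A X"
proof -
  have "finite_resolution A (res_syz X R n) \<Longrightarrow> finite_resolution A X"
  proof (induction n)
    case (Suc n)
    show ?case
      by (rule Suc.IH, rule finite_resolution_extend[OF res_projective[OF X] res_fg[OF X] res_map_hom[OF X] res_map_surj[OF X]])
        (use Suc.prems in \<open>simp only: res_syz_Suc[OF X]\<close>)
  qed simp
  then show ?thesis using finite_resolution_projective[OF P] .
qed

lemma proj_dim_finite:
  assumes "finite_resolution A M"
  shows "proj_dim A M < \<infinity>"
proof -
  obtain d R where "projective_resolution A M R" "\<forall>i > d. zero_module (pr_mod R i)"
    using assms by (auto simp: finite_resolution_def)
  then have "proj_dim A M \<le> enat d"
    unfolding proj_dim_def by (intro Inf_lower) blast
  also have "enat d < \<infinity>" by simp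
  finally show ?thesis .
qed

section \<open>Periodic modules\<close>

lemma minimal_resolution_some:
  fixes X :: "'a univ_module"
  assumes "right_noetherian A" "semiperfect A" "fg_module A X"
  shows "projective_resolution A X (SOME R. minimal_projective_resolution A X R)"
  using someI_ex[OF minimal_resolution_exists[OF assms]] by (simp add: minimal_projective_resolution_def)

lemma syzygy_res_syz: "syzygy A u X = res_syz X (SOME R. minimal_projective_resolution A X R) u"
  by (cases u) simp_all

lemma res_syz_fg:
  assumes "right_noetherian A" "fg_module A X" "projective_resolution A X R"
  shows "fg_module A (res_syz X R u)"
proof (cases u)
  case (Suc v)
  note X = fg_right_module[OF assms(2)]
  show ?thesis unfolding Suc res_syz_Suc[OF X assms(3)]
    by (rule fg_submodule[OF assms(1) res_fg res_kernel_submodule]) (rule X assms(3))+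
qed (use assms in simp)

text \<open>Taking l-th syzygies of the statement for k makes the l-th syzygy of \<open>X\<close> a
  stable retract of the one of index (k + 1) l, and periodicity replaces the former by
  \<open>X\<close>. Stability is needed because R continues beyond index l as one fixed resolution,
  which need not repeat the terms that the isomorphism would predict.\<close>

lemma stable_retract_period:
  assumes X: "right_module A X" "projective_resolution A X R" and per: "mod_iso A (res_syz X R l) X"
  shows "stable_retract A X (res_syz X R (k * l))"
proof (induction k)
  case 0
  show ?case using stable_retractI[OF X(1) mod_hom_id[OF X(1)] mod_hom_id[OF X(1)]] by simp
next
  case (Suc k)
  let ?K = "res_syz X R l" and ?L = "res_syz X R (Suc k * l)"
  note mK = res_syz_right_module[OF X, of l]
  interpret X: right_module A X by (rule X(1))
  obtain i j where ij: "i \<in> mod_hom A ?K X" "j \<in> mod_hom A X ?K" "\<And>y. y \<in> carrier X \<Longrightarrow> i (j y) = y"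
    by (rule mod_iso_sym[OF per mK X(1)]) blast
  have "stable_retract A ?K (res_syz (res_syz X R (k * l)) (res_drop R (k * l)) l)"
    by (rule stable_retract_syz[OF res_syz_right_module[OF X] projective_resolution_drop[OF X(2)] X Suc])
  then have "stable_retract A ?K ?L" by (simp add: res_syz_drop add.commute)
  then obtain f g and Q :: "'a univ_module" and s t where fg: "f \<in> mod_hom A ?K ?L" "g \<in> mod_hom A ?L ?K"
    "projective_module A Q" "s \<in> mod_hom A ?K Q" "t \<in> mod_hom A Q ?K"
    "\<And>x. x \<in> carrier ?K \<Longrightarrow> g (f x) = x \<oplus>\<^bsub>?K\<^esub> t (s x)"
    unfolding stable_retract_def by blast
  have 1: "compose (carrier X) f j \<in> mod_hom A X ?L" by (rule mod_hom_compose[OF ij(2) fg(1) X(1)])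
  have 2: "compose (carrier ?L) i g \<in> mod_hom A ?L X"
    by (rule mod_hom_compose[OF fg(2) ij(1) res_syz_right_module[OF X]])
  have 3: "compose (carrier X) s j \<in> mod_hom A X Q" by (rule mod_hom_compose[OF ij(2) fg(4) X(1)])
  have 4: "compose (carrier Q) i t \<in> mod_hom A Q X"
    by (rule mod_hom_compose[OF fg(5) ij(1) projective_right_module[OF fg(3)]])
  have "compose (carrier ?L) i g (compose (carrier X) f j x) =
      x \<oplus>\<^bsub>X\<^esub> compose (carrier Q) i t (compose (carrier X) s j x)" if x: "x \<in> carrier X" for x
  proof -
    note jx = mod_hom_closed[OF ij(2) x]
    have "i (g (f (j x))) = i (j x) \<oplus>\<^bsub>X\<^esub> i (t (s (j x)))"
      using mod_hom_add[OF ij(1) jx mod_hom_closed[OF fg(5) mod_hom_closed[OF fg(4) jx]]] fg(6)[OF jx] by simp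
    then show ?thesis
      using x mod_hom_closed[OF fg(1) jx] mod_hom_closed[OF fg(4) jx] ij(3)[OF x]
      by (simp add: compose_eq del: mult_Suc)
  qed
  then show ?case unfolding stable_retract_def using 1 2 3 4 fg(3) by blast
qed

text \<open>Vanishing extends \<open>g\<close> to a map \<open>h\<close> on the projective module
  \<open>?P\<close> containing the syzygy. Then the identity of \<open>X\<close> is \<open>h\<close>
  after \<open>f\<close> minus \<open>t\<close> after \<open>s\<close>, so \<open>X\<close> is a
  retract of the sum of \<open>?P\<close> and \<open>Q\<close>.\<close>

lemma projective_if_stable_retract_syz:
  assumes X: "right_module A X" "projective_resolution A X R"
    and sr: "stable_retract A X (res_syz X R (Suc i))" and v: "ext_vanish A X R i X"
  shows "projective_module A X"
proof -
  let ?K = "res_syz X R (Suc i)" and ?P = "pr_mod R i"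
  interpret X: right_module A X by (rule X(1))
  obtain f g and Q :: "'a univ_module" and s t where fg: "f \<in> mod_hom A X ?K" "g \<in> mod_hom A ?K X"
    "projective_module A Q" "s \<in> mod_hom A X Q" "t \<in> mod_hom A Q X"
    "\<And>x. x \<in> carrier X \<Longrightarrow> g (f x) = x \<oplus>\<^bsub>X\<^esub> t (s x)"
    using sr unfolding stable_retract_def by blast
  obtain h where h: "h \<in> mod_hom A ?P X" "\<And>x. x \<in> carrier ?K \<Longrightarrow> h x = g x"
    by (rule ext_vanishD[OF v fg(2)]) blast
  have f: "f \<in> mod_hom A X ?P"
    by (rule mod_hom_uncorestrict[where U = "carrier ?K"])
      (use fg(1) carrier_res_syz_Suc[OF X, of _ i] in \<open>auto simp: res_syz_Suc[OF X] simp del: res_syz.simps(2)\<close>)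
  note mQ = projective_right_module[OF fg(3)]
  interpret Q: right_module A Q by (rule mQ)
  \<comment> \<open>The negative of \<open>s\<close>, since \<open>projective_retract_sum\<close>
    expects a sum.\<close>
  let ?s = "\<lambda>x\<in>carrier X. (\<lambda>x\<in>carrier X. \<zero>\<^bsub>Q\<^esub>) x \<ominus>\<^bsub>Q\<^esub> s x"
  have s': "?s \<in> mod_hom A X Q" by (intro mod_hom_diff mod_hom_const_zero fg X(1) mQ)
  show ?thesis
  proof (rule projective_retract_sum[OF X(1) res_projective[OF X] fg(3) f h(1) s' fg(5)])
    fix x assume x: "x \<in> carrier X"
    note sx = mod_hom_closed[OF fg(4) x]
    have "t (?s x) = \<ominus>\<^bsub>X\<^esub> t (s x)"
      using x sx mod_hom_neg[OF fg(5) mQ X(1) sx] by (simp add: a_minus_def)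
    then show "x = h (f x) \<oplus>\<^bsub>X\<^esub> t (?s x)"
      using h(2)[OF mod_hom_closed[OF fg(1) x]] fg(6)[OF x] x mod_hom_closed[OF fg(5) sx]
      by (simp add: X.M.a_assoc X.M.r_neg)
  qed
qed

text \<open>The vanishing hypothesis may refer to any resolution \<open>R\<close>, while the
  conclusion concerns the minimal one selected inside \<open>syzygy\<close>; this freedom is what
  allows the resolution selected by \<open>Ext\<close> to be fed in.\<close>

lemma syzygy_projective:
  fixes N :: "'a univ_module"
  assumes A: "ring A" "right_noetherian A" "semiperfect A" and id: "inj_dim A (regular_module A) = enat n"
    and per: "\<forall>X \<in> CM n A. indecomposable_module A X \<and> \<not> projective_module A X \<longrightarrow> periodic A X"
    and N: "fg_module A N" and R: "projective_resolution A N R" and v: "\<And>i. i \<ge> n \<Longrightarrow> ext_vanish A N R i N"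
  shows "projective_module A (syzygy A n N)"
proof (rule ccontr)
  let ?R = "SOME R. minimal_projective_resolution A N R" and ?Z = "syzygy A n N"
  assume np: "\<not> projective_module A ?Z"
  note mN = fg_right_module[OF N]
  have R1: "projective_resolution A N ?R" by (rule minimal_resolution_some[OF A(2,3) N])
  have fgZ: "fg_module A ?Z" unfolding syzygy_res_syz by (rule res_syz_fg[OF A(2) N R1])
  note mZ = fg_right_module[OF fgZ]
  \<comment> \<open>The identity as a stable retraction compares \<open>R\<close> with the chosen
    minimal resolution of the same module.\<close>
  have "stable_retract A N N" by (rule stable_retractI[OF mN mod_hom_id[OF mN] mod_hom_id[OF mN]]) simp
  then have v1: "ext_vanish A N ?R i N" if "i \<ge> n" for i
    by (rule ext_vanish_stable_retract[OF mN R mN R1 _ mN v[OF that]])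
  have vZ: "ext_vanish A ?Z (res_drop ?R n) i ?Z" if "i \<ge> n" for i
    unfolding syzygy_res_syz ext_vanish_drop by (rule ext_vanish_syz[OF A(1) id mN R1 v1 that])
  have RZ: "projective_resolution A ?Z (res_drop ?R n)"
    unfolding syzygy_res_syz by (rule projective_resolution_drop[OF R1])
  obtain U V where ds: "internal_direct_sum A ?Z U V" and ind: "indecomposable_module A (restrict_module ?Z V)"
    and npV: "\<not> projective_module A (restrict_module ?Z V)"
    by (rule nonprojective_indecomposable_summand[OF A(2) fgZ np])
  let ?V = "restrict_module ?Z V"
  have sV: "submodule V A ?Z" using ds by (simp add: internal_direct_sum_def)
  have fgV: "fg_module A ?V" by (rule fg_submodule[OF A(2) fgZ sV])
  note mV = fg_right_module[OF fgV]
  have "mod_iso A ?V ?V"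
    unfolding mod_iso_def by (rule bexI[OF _ mod_hom_id[OF mV]]) (auto simp: bij_betw_def inj_on_def)
  then have "direct_summand A ?V ?Z"
    using internal_direct_sum_commute[OF ds mZ] by (auto simp: direct_summand_def)
  \<comment> \<open>Immediate from the definition of \<open>CM\<close>, as \<open>?V\<close> is a
    summand of \<open>syzygy A n N\<close> exactly as it is chosen there.\<close>
  then have "?V \<in> CM n A" using fgV N by (auto simp: CM_def)
  then have "periodic A ?V" using per ind npV by blast
  then obtain l where l: "l \<ge> 1" "mod_iso A (syzygy A l ?V) ?V" by (auto simp: periodic_def)
  let ?R2 = "SOME R. minimal_projective_resolution A ?V R"
  have R2: "projective_resolution A ?V ?R2" by (rule minimal_resolution_some[OF A(2,3) fgV])
  obtain q where q: "q \<in> mod_hom A ?Z ?V" "\<And>v. v \<in> V \<Longrightarrow> q v = v"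
    by (rule internal_direct_sum_projection[OF ds mZ]) blast
  note iV = mod_hom_incl[OF mZ sV]
  have "stable_retract A ?V ?Z" by (rule stable_retractI[OF mV iV q(1)]) (simp add: q(2))
  \<comment> \<open>The two variables are treated differently: the first passes to the summand by a
    stable retract, which also changes the resolution; the second, in the next step, by a strict
    retract.\<close>
  then have "ext_vanish A ?V ?R2 i ?Z" if "i \<ge> n" for i
    by (rule ext_vanish_stable_retract[OF mZ RZ mV R2 _ mZ vZ[OF that]])
  then have vV: "ext_vanish A ?V ?R2 i ?V" if "i \<ge> n" for i
    by (rule ext_vanish_retract[OF mV R2 _ iV q(1)]) (simp_all add: q(2) that)
  \<comment> \<open>The factor n + 1 brings the multiple of the period above \<open>n\<close>; its
    predecessor \<open>i\<close> is then at least \<open>n\<close>, where vanishing is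
    known.\<close>
  have "Suc n \<le> Suc n * l" using mult_le_mono2[OF l(1), of "Suc n"] by simp
  then obtain i where i: "Suc n * l = Suc i" "i \<ge> n" by (cases "Suc n * l") auto
  have "stable_retract A ?V (res_syz ?V ?R2 (Suc i))"
    using stable_retract_period[OF mV R2 l(2)[unfolded syzygy_res_syz[of A l ?V]], of "Suc n"] unfolding i(1) .
  then have "projective_module A ?V"
    by (rule projective_if_stable_retract_syz[OF mV R2 _ vV[OF i(2)]])
  then show False using npV by blast
qed

theorem theorem0p2:
  fixes A :: "('a, 'r) ring_scheme" and n :: nat and M :: "('a, 'm) module"
  assumes "ring A"
    and "two_sided_noetherian A"
    and "semiperfect A"
    and "iwanaga_gorenstein n A"
    and "\<forall>X \<in> CM n A. indecomposable_module A X \<and> \<not> projective_module A X \<longrightarrow> periodic A X"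
    and "fg_module A M"
  shows "((\<forall>u > n. trivial_group (Ext A u M M)) \<longrightarrow> proj_dim A M < \<infinity>) \<and>
    (self_orthogonal A M \<longrightarrow> proj_dim A M < \<infinity>)"
proof -
  have A: "right_noetherian A" using assms(2) by (simp add: two_sided_noetherian_def)
  have id: "inj_dim A (regular_module A) = enat n" using assms(4) by (simp add: iwanaga_gorenstein_def)
  note m = fg_right_module[OF assms(6)]
  have main: "proj_dim A M < \<infinity>" if t: "\<forall>u > n. trivial_group (Ext A u M M)"
  proof -
    \<comment> \<open>\<open>N\<close> is a copy of \<open>M\<close> on lists, to which
      \<open>syzygy\<close> and \<open>CM\<close> apply.\<close>
    obtain N :: "'a univ_module" and f g where N: "fg_module A N"
      and fg: "f \<in> mod_hom A M N" "g \<in> mod_hom A N M"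
      "\<And>x. x \<in> carrier M \<Longrightarrow> g (f x) = x" "\<And>y. y \<in> carrier N \<Longrightarrow> f (g y) = y"
      by (rule univ_copy[OF assms(6)]) blast
    note mN = fg_right_module[OF N]
    have R1: "projective_resolution A N (SOME R. minimal_projective_resolution A N R)" (is "projective_resolution A N ?R1")
      by (rule minimal_resolution_some[OF A assms(3) N])
    \<comment> \<open>This is the resolution that \<open>Ext\<close> selects for \<open>M\<close>.
      Some resolution exists because that of \<open>N\<close> can be transported back, so the choice
      is legitimate.\<close>
    define R where "R = (SOME R. projective_resolution A M R)"
    have R: "projective_resolution A M R"
      unfolding R_def by (rule someI[of _ "res_transport g ?R1"]) (rule res_transport(2)[OF R1 mN m fg(2,1,4,3)])
    let ?R = "res_transport f R"
    note tr = res_transport[OF R m mN fg]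
    have P: "pr_mod ?R i = pr_mod R i" for i by (simp add: res_transport_def)
    have mP: "right_module A (pr_mod R i)" for i
      using R by (simp add: projective_resolution_def projective_module_def)
    \<comment> \<open>By the index shift this concerns degree i + 1, which exceeds \<open>n\<close>.
      An extension problem into \<open>N\<close> is carried to \<open>M\<close> by \<open>g\<close>,
      solved there and brought back by \<open>f\<close>.\<close>
    have "ext_vanish A N ?R i N" if i: "i \<ge> n" for i
    proof (rule ext_vanishI)
      fix k assume k: "k \<in> mod_hom A (res_syz N ?R (Suc i)) N"
      have S: "res_syz N ?R (Suc i) = pr_syzygy M R i" by (simp add: tr(1) P)
      have mS: "right_module A (pr_syzygy M R i)"
        using res_syz_right_module[OF mN tr(2), of "Suc i"] unfolding S .
      have gk: "compose (carrier (pr_syzygy M R i)) g k \<in> mod_hom A (pr_syzygy M R i) M"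
        by (rule mod_hom_compose[OF k[unfolded S] fg(2) mS])
      have "trivial_group (Ext A (Suc i) M M)" using t i by simp
      then obtain h where h: "h \<in> mod_hom A (pr_mod R i) M"
        "\<And>x. x \<in> pr_kernel M R i \<Longrightarrow> h x = compose (carrier (pr_syzygy M R i)) g k x"
        unfolding Ext_def Let_def R_def[symmetric]
        using Ext_trivialD[OF R m m _ gk] by blast
      have "compose (carrier (pr_mod R i)) f h x = k x" if x: "x \<in> pr_kernel M R i" for x
      proof -
        have "x \<in> carrier (pr_mod R i)" using x by (cases i) (auto simp: a_kernel_def')
        moreover have "k x \<in> carrier N" using mod_hom_closed[OF k[unfolded S]] x by simp
        ultimately show ?thesis using h(2)[OF x] x fg(4) by (simp add: compose_eq)
      qed
      then show "\<exists>h\<in>mod_hom A (pr_mod ?R i) N. \<forall>x\<in>carrier (res_syz N ?R (Suc i)). h x = k x"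
        using mod_hom_compose[OF h(1) fg(1) mP] unfolding S P by (intro bexI[of _ "compose (carrier (pr_mod R i)) f h"]) simp_all
    qed
    note vanish = this
    have "projective_module A (syzygy A n N)"
      by (rule syzygy_projective[OF assms(1) A assms(3) id assms(5) N tr(2) vanish])
    then have "finite_resolution A N"
      unfolding syzygy_res_syz using res_syz_fg[OF A N R1] by (intro finite_resolution_syz[OF mN R1])
    then obtain d R' where R': "projective_resolution A N R'" "\<forall>i > d. zero_module (pr_mod R' i)"
      by (auto simp: finite_resolution_def)
    then have "finite_resolution A M"
      unfolding finite_resolution_def using res_transport(2)[OF R'(1) mN m fg(2,1,4,3)]
      by (intro exI[of _ d] exI[of _ "res_transport g R'"]) (simp add: res_transport_def)
    then show ?thesis by (rule proj_dim_finite)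
  qed
  \<comment> \<open>Self-orthogonality covers all degrees from 1 on, and every u above n is at least
    1.\<close>
  then show ?thesis by (auto simp: self_orthogonal_def)
qed

end
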